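(* Let $f=Ex(\cdot,\mathcal{M})$ for some zonoid $\mathcal{M}\subset\mathbb{R}^2$. For integers $M,k\ge1$ let $\mathcal{M}_{M,k}=Z(V_{M,k})$, where $V_{M,k}$ is any minimiser of $V\mapsto\|P_M(Ex(\cdot,Z(V))-f)\|_2^2$ over all lists $V$ of $k$ vectors in $\mathbb{R}^2$. Then there are constants $C_1,C_2>0$, independent of $M$ and $k$, such that for all $M,k\ge 1$ $$\|Ex(\cdot,\mathcal{M}_{M,k})-f\|_2^2\leq\frac{C_1}{k^2}+\frac{C_2}{M^3}+2\sum_{|n|\geq M}|\hat f(n)|^2 .$$
   Context: For a list $V=(v_i)_{i=1}^k$ of vectors in $\mathbb{R}^2$ (zero vectors allowed), the zonotope is $Z(V)=\{\sum_{i=1}^k a_iv_i:a_i\in[-\frac12,\frac12]\}$. A zonoid is a Hausdorff-metric limit of zonotopes; in $\mathbb{R}^2$ these are exactly the non-empty compact convex sets $\mathcal{M}$ with $-\mathcal{M}=\mathcal{M}$. The excluded area function is $Ex(\theta,\mathcal{M})=|\mathcal{M}-R_\theta\mathcal{M}|$, where $R_\theta$ is the counterclockwise rotation by $\theta$, $A-B=\{a-b:a\in A,b\in B\}$ and $|\cdot|$ is area. $\|\cdot\|_2$ is the norm of $L^2(0,2\pi)$, and $P_M$ is the orthogonal projection of $L^2(0,2\pi)$ onto $\mathrm{span}\{\cos(2m\theta):0\le m\le M\}$ (the first $M$ even Fourier modes; the excluded area function of a zonoid is even and $\pi$-periodic). $\hat f(n)=\frac{1}{2\pi}\int_0^{2\pi}f(\theta)\cos(n\theta)\,d\theta$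 for $n\in\mathbb{Z}$. *)

theory Defs
  imports "HOL-Analysis.Analysis"
begin

definition zonotope :: "(real^2) list \<Rightarrow> (real^2) set" where
  "zonotope V = {\<Sum>i<length V. a i *\<^sub>R V ! i | a. \<forall>i<length V. a i \<in> {-1/2..1/2}}"

text \<open>The Hausdorff metric; only meaningful for non-empty bounded sets, since \<open>infdist x {} = 0\<close> and the
  suprema are unspecified on unbounded families.\<close>

definition hausdorff_dist :: "'a::metric_space set \<Rightarrow> 'a set \<Rightarrow> real" where
  "hausdorff_dist S T = max (SUP x\<in>S. infdist x T) (SUP y\<in>T. infdist y S)"

definition zonoid :: "(real^2) set \<Rightarrow> bool" where
  "zonoid K \<longleftrightarrow> compact K \<and> K \<noteq> {} \<and>
     (\<exists>V. (\<lambda>n. hausdorff_dist (zonotope (V n)) K) \<longlonglongrightarrow> 0)"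

definition rot :: "real \<Rightarrow> real^2 \<Rightarrow> real^2" where
  "rot \<theta> v = vector [vector [cos \<theta>, - sin \<theta>], vector [sin \<theta>, cos \<theta>]] *v v"

definition excluded_area :: "real \<Rightarrow> (real^2) set \<Rightarrow> real" where
  "excluded_area \<theta> K = measure lebesgue {a - b | a b. a \<in> K \<and> b \<in> rot \<theta> ` K}"

definition l2_inner :: "(real \<Rightarrow> real) \<Rightarrow> (real \<Rightarrow> real) \<Rightarrow> real" where
  "l2_inner g h = (LINT \<theta>:{0<..<2*pi}|lebesgue. g \<theta> * h \<theta>)"

definition l2_norm :: "(real \<Rightarrow> real) \<Rightarrow> real" where
  "l2_norm g = sqrt (l2_inner g g)"

definition even_modes :: "nat \<Rightarrow> (real \<Rightarrow> real) set" where
  "even_modes M = {\<lambda>\<theta>. \<Sum>m\<le>M. c m * cos (2 * real m * \<theta>) | c. True}"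

text \<open>The elements of \<open>even_modes M\<close> are continuous and periodic, so they are determined pointwise
  by their class in \<open>L\<^sup>2(0,2\<pi>)\<close>: the description below is unique as a function, not
  merely almost everywhere, and it exists for every square-integrable \<open>g\<close>.\<close>

definition modes_proj :: "nat \<Rightarrow> (real \<Rightarrow> real) \<Rightarrow> (real \<Rightarrow> real)" where
  "modes_proj M g =
     (THE p. p \<in> even_modes M \<and> (\<forall>h\<in>even_modes M. l2_inner (\<lambda>\<theta>. g \<theta> - p \<theta>) h = 0))"

definition cosine_mode :: "(real \<Rightarrow> real) \<Rightarrow> int \<Rightarrow> real" where
  "cosine_mode g n = 1 / (2*pi) * (LINT \<theta>:{0<..<2*pi}|lebesgue. g \<theta> * cos (of_int n * \<theta>))"

end

(* The area formula for planar zonotopes gives, for vectors r_i (cos p_i, sin p_i),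
     Ex(t, Z) = (sum over i, j of r_i r_j (|sin (p_j - p_i)| + |sin (t + p_j - p_i)|)),
   and zonoids are uniform limits of these functions.  Split Ex(V) - f by the projection P_M.
   Inside the modes, minimality compares V with k vectors obtained by rounding the directions of a
   zonotope close to the zonoid to multiples of pi/k, which costs O(1/k) uniformly in t; minimality
   also bounds the mean of Ex(V) and hence (sum of r_i)^2.
   Outside the modes, (I - P_M) Ex(V) and (I - P_M) f are controlled by the Fourier tail of |sin|,
   which is O(M^(-3)) in square norm: its coefficients are explicit, and Parseval reduces to
   sum 1/n^2 = pi^2/6.  So even the tail of f is absorbed by C2/M^3. *)

theory Submission
  imports Defs "HOL-Real_Asymp.Real_Asymp"
begin

section \<open>Planar zonotopes\<close>


text \<open>The minimiser is controlled only through its first modes, so a large oscillation beyond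
  them has to be excluded. Two facts do this: the mean is itself a mode, and the weights
  \<open>r i * r j\<close> are nonnegative, so a bounded mean bounds the total length of the vectors
  and with it all modes at once. Every later estimate depends on the total length alone, not on the
  number of vectors; this matters because zonotopes close to the zonoid may need more and more
  vectors as the tolerance shrinks with \<open>M\<close> and \<open>k\<close>. The exponent 3 arises
  because the coefficients of |sin| have size 1/m^2, so that their squares have a tail of order
  1/M^3. The coefficients of Ex are never computed: the projection is the best approximation, so the
  residual is bounded by the distance to any convenient even cosine polynomial.\<close>

definition det2 :: "real^2 \<Rightarrow> real^2 \<Rightarrow> real" where
  "det2 u w = u$1 * w$2 - u$2 * w$1"

text \<open>Minkowski sum with the centred segment of direction \<open>v\<close>. Zonotopes arise by
  repeating it, which turns the description by coefficients into a recursion fit for induction on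
  the list.\<close>

definition seg_sum :: "real^2 \<Rightarrow> (real^2) set \<Rightarrow> (real^2) set" where
  "seg_sum v A = {s *\<^sub>R v + x | s x. s \<in> {-1/2..1/2} \<and> x \<in> A}"

lemma zonotope_Nil [simp]: "zonotope [] = {0}"
  by (auto simp: zonotope_def)

lemma zonotope_Cons: "zonotope (v # V) = seg_sum v (zonotope V)"
proof (intro equalityI subsetI)
  fix x assume "x \<in> zonotope (v # V)"
  then obtain a where a: "x = (\<Sum>i<length (v#V). a i *\<^sub>R (v#V) ! i)"
    "\<forall>i<length (v#V). a i \<in> {-1/2..1/2}" unfolding zonotope_def by blast
  have "x = a 0 *\<^sub>R v + (\<Sum>i<length V. a (Suc i) *\<^sub>R V ! i)"
    unfolding a(1) by (simp add: sum.lessThan_Suc_shift del: sum.lessThan_Suc)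
  moreover have "(\<Sum>i<length V. a (Suc i) *\<^sub>R V ! i) \<in> zonotope V"
    unfolding zonotope_def using a(2) by (intro CollectI exI[of _ "\<lambda>i. a (Suc i)"]) auto
  ultimately show "x \<in> seg_sum v (zonotope V)" using a(2) unfolding seg_sum_def by force
next
  fix x assume "x \<in> seg_sum v (zonotope V)"
  then obtain s a where a: "x = s *\<^sub>R v + (\<Sum>i<length V. a i *\<^sub>R V ! i)"
    "s \<in> {-1/2..1/2}" "\<forall>i<length V. a i \<in> {-1/2..1/2}" unfolding zonotope_def seg_sum_def by blast
  show "x \<in> zonotope (v # V)" unfolding zonotope_def
  proof (intro CollectI exI conjI)
    show "x = (\<Sum>i<length (v#V). case_nat s a i *\<^sub>R (v#V) ! i)"
      using a(1) by (simp add: sum.lessThan_Suc_shift del: sum.lessThan_Suc)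
    show "\<forall>i<length (v#V). case_nat s a i \<in> {-1/2..1/2}"
      using a(2,3) by (auto split: nat.split)
  qed
qed

lemma zero_in_zonotope: "0 \<in> zonotope V"
  by (induction V) (auto simp: zonotope_Cons seg_sum_def intro!: exI[of _ 0])

lemma zonotope_append:
  "zonotope (V @ W) = {x + y | x y. x \<in> zonotope V \<and> y \<in> zonotope W}"
proof (induction V)
  case Nil
  then show ?case by simp
next
  case (Cons v V)
  have "seg_sum v {x + y | x y. x \<in> A \<and> y \<in> B} = {x + y | x y. x \<in> seg_sum v A \<and> y \<in> B}" for A B
    unfolding seg_sum_def by (auto; metis add.assoc)
  then show ?case using Cons by (simp add: zonotope_Cons)
qed

lemma zonotope_map_linear: "linear f \<Longrightarrow> zonotope (map f V) = f ` zonotope V"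
proof (induction V)
  case Nil
  then show ?case by (simp add: linear_0)
next
  case (Cons v V)
  have "seg_sum (f v) (f ` A) = f ` seg_sum v A" for A
    unfolding seg_sum_def using Cons.prems
    by (auto simp: linear_add linear_scale image_iff; metis linear_add linear_scale)
  then show ?case using Cons by (simp add: zonotope_Cons)
qed

lemma zonotope_uminus: "x \<in> zonotope V \<Longrightarrow> - x \<in> zonotope V"
proof (induction V arbitrary: x)
  case (Cons v V)
  then obtain s y where "x = s *\<^sub>R v + y" "s \<in> {-1/2..1/2}" "y \<in> zonotope V"
    by (auto simp: zonotope_Cons seg_sum_def)
  then have "- x = (- s) *\<^sub>R v + (- y)" "- s \<in> {-1/2..1/2}" "- y \<in> zonotope V"
    using Cons.IH by auto
  then show ?case unfolding zonotope_Cons seg_sum_def by blast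
qed auto

lemma compact_linear_image:
  fixes f :: "'a::euclidean_space \<Rightarrow> 'b::euclidean_space"
  assumes "linear f" "compact S"
  shows "compact (f ` S)"
  using assms by (intro compact_continuous_image linear_continuous_on)
    (simp_all add: linear_conv_bounded_linear)

lemma seg_sum_image: "seg_sum v A = (\<lambda>(s, x). s *\<^sub>R v + x) ` ({-1/2..1/2} \<times> A)"
  by (force simp: seg_sum_def)

lemma compact_seg_sum: "compact A \<Longrightarrow> compact (seg_sum v A)"
  unfolding seg_sum_image
  by (intro compact_continuous_image compact_Times) (auto intro!: continuous_intros simp: case_prod_unfold)

lemma convex_seg_sum: "convex A \<Longrightarrow> convex (seg_sum v A)"
  unfolding seg_sum_image
  by (intro convex_linear_image convex_Times)
     (auto simp: case_prod_unfold linear_iff algebra_simps)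

lemma compact_zonotope: "compact (zonotope V)"
  by (induction V) (auto simp: zonotope_Cons compact_seg_sum)

lemma convex_zonotope: "convex (zonotope V)"
  by (induction V) (auto simp: zonotope_Cons convex_seg_sum)

section \<open>Rotations and the determinant form\<close>

lemma rot_nth [simp]:
  "rot t v $ 1 = cos t * v$1 - sin t * v$2" "rot t v $ 2 = sin t * v$1 + cos t * v$2"
  by (simp_all add: rot_def matrix_vector_mult_def sum_2)

lemma linear_rot: "linear (rot t)"
  unfolding rot_def by (rule matrix_vector_mul_linear)

lemma norm_vec2: "norm (v :: real^2) = sqrt ((v$1)\<^sup>2 + (v$2)\<^sup>2)"
  by (simp add: norm_vec_def L2_set_def sum_2)

lemma norm_rot: "norm (rot t v) = norm v"
proof -
  have "(rot t v $ 1)\<^sup>2 + (rot t v $ 2)\<^sup>2 = ((sin t)\<^sup>2 + (cos t)\<^sup>2) * ((v$1)\<^sup>2 + (v$2)\<^sup>2)"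
    unfolding rot_nth by algebra
  then show ?thesis by (simp add: norm_vec2)
qed

lemma det2_rot: "det2 (rot t u) (rot t w) = det2 u w"
proof -
  have "det2 (rot t u) (rot t w) = ((sin t)\<^sup>2 + (cos t)\<^sup>2) * det2 u w"
    unfolding det2_def rot_nth by algebra
  then show ?thesis by simp
qed

text \<open>Zonotopes are symmetric about the origin, so subtracting the rotated copy is the same as
  adding it, and a sum of zonotopes belongs to the concatenated list.\<close>

lemma difference_rot_zonotope:
  "{a - b | a b. a \<in> zonotope V \<and> b \<in> rot t ` zonotope V} = zonotope (V @ map (rot t) V)"
  unfolding zonotope_append zonotope_map_linear[OF linear_rot, symmetric]
  by (auto, metis zonotope_uminus uminus_add_conv_diff add.commute,
      metis zonotope_uminus diff_minus_eq_add)

lemma linear_det2: "linear (det2 v)"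
  by (auto simp: linear_iff det2_def algebra_simps)

text \<open>A linear functional sends each segment to a centred interval of length |det2 v x|, and
  lengths add. The resulting length is what a further segment \<open>v\<close> will add to the
  area.\<close>

lemma det2_zonotope:
  "det2 v ` zonotope V = {- (\<Sum>x\<leftarrow>V. \<bar>det2 v x\<bar>) / 2 .. (\<Sum>x\<leftarrow>V. \<bar>det2 v x\<bar>) / 2}"
proof (induction V)
  case Nil
  then show ?case by (simp add: det2_def)
next
  case (Cons w V)
  define d S where "d = det2 v w" and "S = (\<Sum>x\<leftarrow>V. \<bar>det2 v x\<bar>)"
  have S: "S \<ge> 0" unfolding S_def by (induction V) auto
  have "det2 v ` zonotope (w # V) = (\<lambda>(s, y). s * d + y) ` ({-1/2..1/2} \<times> det2 v ` zonotope V)"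
    unfolding zonotope_Cons seg_sum_image d_def
    by (force simp: linear_add[OF linear_det2] linear_scale[OF linear_det2] image_iff)
  also have "\<dots> = (\<lambda>(s, y). s * d + y) ` ({-1/2..1/2} \<times> {- S / 2 .. S / 2})"
    using Cons.IH by (simp add: S_def)
  also have "\<dots> = {- (\<bar>d\<bar> + S) / 2 .. (\<bar>d\<bar> + S) / 2}"
  proof (intro equalityI subsetI)
    fix x assume "x \<in> (\<lambda>(s, y). s * d + y) ` ({-1/2..1/2} \<times> {- S / 2 .. S / 2})"
    then obtain s y where x: "x = s * d + y" "\<bar>s\<bar> \<le> 1/2" "\<bar>y\<bar> \<le> S/2" by (auto simp: abs_le_iff)
    have "\<bar>s * d\<bar> \<le> \<bar>d\<bar> / 2" using mult_right_mono[OF x(2), of "\<bar>d\<bar>"] by (simp add: abs_mult)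
    then show "x \<in> {- (\<bar>d\<bar> + S) / 2 .. (\<bar>d\<bar> + S) / 2}" using x by (auto simp: abs_le_iff field_simps)
  next
    fix x assume x: "x \<in> {- (\<bar>d\<bar> + S) / 2 .. (\<bar>d\<bar> + S) / 2}"
    show "x \<in> (\<lambda>(s, y). s * d + y) ` ({-1/2..1/2} \<times> {- S / 2 .. S / 2})"
    proof (cases "\<bar>d\<bar> + S = 0")
      case True
      then have "d = 0" "S = 0" "x = 0" using x S by auto
      then show ?thesis by (auto simp: image_iff intro!: bexI[of _ 0])
    next
      case False
      \<comment> \<open>\<open>x\<close> is the fraction \<open>r\<close> of the total length;
        giving both summands that same fraction keeps each within its half-length, and
        \<open>sgn d\<close> corrects the orientation.\<close>
      define r where "r = x / (\<bar>d\<bar> + S)"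
      have pos: "\<bar>d\<bar> + S > 0" using False S by linarith
      have r: "-1/2 \<le> r" "r \<le> 1/2" using x pos by (auto simp: r_def field_simps)
      have "x = r * (\<bar>d\<bar> + S)" using pos by (simp add: r_def)
      then have "x = (r * sgn d) * d + r * S" by (simp add: algebra_simps sgn_mult_abs abs_sgn)
      moreover have "r * sgn d \<in> {-1/2..1/2}" using r by (auto simp: sgn_if)
      moreover have "r * S \<in> {- S/2..S/2}"
        using mult_right_mono[OF r(1) S] mult_right_mono[OF r(2) S] by (auto simp: algebra_simps)
      ultimately show ?thesis by (force simp: image_iff)
    qed
  qed
  finally show ?case by (simp add: d_def S_def)
qed

section \<open>Area of a zonotope\<close>


lemma vimage_slice_convex_compact:
  fixes S :: "(real \<times> real) set"
  assumes "compact S" "convex S" "(x0, y) \<in> S"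
  obtains a b where "a \<le> b" "(\<lambda>x. (x, y)) -` S = {a..b}"
proof -
  let ?T = "(\<lambda>x. (x, y)) -` S"
  have "?T = fst ` (S \<inter> (UNIV \<times> {y}))" by force
  moreover have "compact (S \<inter> (UNIV \<times> {y}))"
    by (intro compact_Int_closed assms closed_Times) auto
  ultimately have "compact ?T" by (auto intro!: compact_continuous_image continuous_intros)
  moreover have "convex ?T"
    unfolding convex_def
  proof clarify
    fix a b u v :: real assume *: "(a, y) \<in> S" "(b, y) \<in> S" "0 \<le> u" "0 \<le> v" "u + v = 1"
    have "u *\<^sub>R (a, y) + v *\<^sub>R (b, y) \<in> S" by (rule convexD[OF assms(2) *(1,2,3,4,5)])
    moreover have "u *\<^sub>R (a, y) + v *\<^sub>R (b, y) = (u *\<^sub>R a + v *\<^sub>R b, y)"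
      using *(5) by (simp add: distrib_right[symmetric])
    ultimately show "u *\<^sub>R a + v *\<^sub>R b \<in> (\<lambda>x. (x, y)) -` S" by simp
  qed
  ultimately obtain a b where "?T = {a..b}"
    using connected_compact_interval_1 convex_connected by metis
  moreover have "?T \<noteq> {}" using assms(3) by auto
  ultimately show thesis using that by auto
qed

text \<open>Fubini over horizontal slices: a non-empty slice is an interval and grows in length by
  exactly 1, an empty one stays empty. The gain is therefore the length of the shadow on the
  vertical axis.\<close>

lemma emeasure_horizontal_sum:
  fixes S :: "(real \<times> real) set"
  assumes S: "compact S" "convex S"
  shows "emeasure lborel {(s + x, y) | s x y. s \<in> {-1/2..1/2} \<and> (x, y) \<in> S} =
         emeasure lborel S + emeasure lborel (snd ` S)"
proof -
  define S' where "S' = {(s + x, y) | s x y. s \<in> {-1/2..1/2::real} \<and> (x, y) \<in> S}"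
  have "S' = (\<lambda>(s, x, y). (s + x, y)) ` ({-1/2..1/2} \<times> S)" by (force simp: S'_def)
  moreover have "compact ((\<lambda>(s, x, y). (s + x, y)) ` ({-1/2..1/2} \<times> S))"
    by (intro compact_continuous_image compact_Times S) (auto intro!: continuous_intros simp: case_prod_unfold)
  ultimately have "compact S'" by simp
  then have m: "S' \<in> sets borel" "S \<in> sets borel" using S by (auto intro: borel_compact)
  have c: "compact (snd ` S)" by (intro compact_continuous_image S continuous_intros)
  then have ms: "snd ` S \<in> sets lborel" by (auto intro: borel_compact)
  have slice: "emeasure lborel X = (\<integral>\<^sup>+y. emeasure lborel ((\<lambda>x. (x, y)) -` X) \<partial>lborel)"
    if "X \<in> sets borel" for X :: "(real \<times> real) set"
  proof -
    have "X \<in> sets (lborel \<Otimes>\<^sub>M lborel)" using that unfolding lborel_prod by simp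
    from lborel_pair.emeasure_pair_measure_alt2[OF this] show ?thesis by (simp only: lborel_prod)
  qed
  have "emeasure lborel S' = (\<integral>\<^sup>+y. emeasure lborel ((\<lambda>x. (x, y)) -` S') \<partial>lborel)"
    using m by (intro slice)
  also have "\<dots> = (\<integral>\<^sup>+y. emeasure lborel ((\<lambda>x. (x, y)) -` S) + indicator (snd ` S) y \<partial>lborel)"
  proof (intro nn_integral_cong)
    fix y :: real
    show "emeasure lborel ((\<lambda>x. (x, y)) -` S') =
      emeasure lborel ((\<lambda>x. (x, y)) -` S) + indicator (snd ` S) y"
    proof (cases "y \<in> snd ` S")
      case True
      then obtain x0 where "(x0, y) \<in> S" by auto
      then obtain a b where ab: "a \<le> b" "(\<lambda>x. (x, y)) -` S = {a..b}"
        using vimage_slice_convex_compact[OF S] by metis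
      then have mem: "(x, y) \<in> S \<longleftrightarrow> a \<le> x \<and> x \<le> b" for x by (auto simp: set_eq_iff)
      have "(\<lambda>x. (x, y)) -` S' = {a - 1/2..b + 1/2}"
      proof (intro equalityI subsetI)
        fix z assume z: "z \<in> {a - 1/2..b + 1/2}"
        \<comment> \<open>The point of the slice nearest to \<open>z\<close>; the remaining distance
          is at most 1/2.\<close>
        define x where "x = max a (min b z)"
        have "z = (z - x) + x \<and> z - x \<in> {-1/2..1/2} \<and> (x, y) \<in> S"
          using z ab(1) by (auto simp: mem x_def)
        then show "z \<in> (\<lambda>x. (x, y)) -` S'" unfolding S'_def by blast
      qed (auto simp: S'_def mem)
      then show ?thesis using ab True ennreal_plus[of "b - a" 1] by (simp add: add.commute)
    next
      case False
      then have "(\<lambda>x. (x, y)) -` S' = {}" "(\<lambda>x. (x, y)) -` S = {}"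
        by (force simp: S'_def)+
      then show ?thesis using False by simp
    qed
  qed
  also have "\<dots> = (\<integral>\<^sup>+y. emeasure lborel ((\<lambda>x. (x, y)) -` S) \<partial>lborel) + emeasure lborel (snd ` S)"
    using m ms lborel_pair.measurable_emeasure_Pair2[of S]
    by (subst nn_integral_add) (auto simp: lborel_prod)
  also have "\<dots> = emeasure lborel S + emeasure lborel (snd ` S)" using m by (simp add: slice[symmetric])
  finally show ?thesis unfolding S'_def .
qed

text \<open>Carries \<open>real \<times> real\<close>, where Lebesgue measure is a product and
  Fubini applies, over to \<open>real^2\<close>, where the zonotopes live.\<close>

definition vec_of_pair :: "real \<times> real \<Rightarrow> real^2" where
  "vec_of_pair p = vector [fst p, snd p]"

lemma vec_of_pair_nth [simp]: "vec_of_pair p $ 1 = fst p" "vec_of_pair p $ 2 = snd p"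
  by (simp_all add: vec_of_pair_def)

lemma borel_measurable_vec_of_pair [measurable]: "vec_of_pair \<in> borel_measurable borel"
proof -
  have "linear vec_of_pair"
    by (auto simp: linear_iff vec_eq_iff forall_2)
  then show ?thesis by (intro borel_measurable_continuous_onI linear_continuous_on)
      (simp add: linear_conv_bounded_linear)
qed

text \<open>Lebesgue measure is determined by its values on boxes, and the preimage of a box is the
  box with the same sides.\<close>

lemma distr_vec_of_pair: "distr lborel borel vec_of_pair = (lborel :: (real^2) measure)"
proof (rule lborel_eqI[symmetric])
  fix l u :: "real^2"
  assume le: "\<And>b. b \<in> Basis \<Longrightarrow> l \<bullet> b \<le> u \<bullet> b"
  have B: "(Basis :: (real^2) set) = {axis 1 1, axis 2 1}"
    by (auto simp: Basis_vec_def UNIV_2)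
  have ne: "axis 1 1 \<noteq> (axis 2 1 :: real^2)" by (simp add: axis_eq_axis)
  have le': "l $ 1 \<le> u $ 1" "l $ 2 \<le> u $ 2"
    using le[of "axis 1 1"] le[of "axis 2 1"] by (auto simp: B inner_axis)
  have vi: "vec_of_pair -` box l u = box (l$1, l$2) (u$1, u$2)"
    by (auto simp: box_def B inner_axis Basis_prod_def)
  have "emeasure (distr lborel borel vec_of_pair) (box l u) = emeasure lborel (box (l$1, l$2) (u$1, u$2))"
    by (subst emeasure_distr) (auto simp: vi)
  also have "\<dots> = (\<Prod>b\<in>Basis. ((u$1, u$2) - (l$1, l$2)) \<bullet> b)"
    using le' by (intro emeasure_lborel_box) (auto simp: Basis_prod_def)
  also have "(\<Prod>b\<in>Basis. ((u$1, u$2) - (l$1, l$2)) \<bullet> b) = (u$1 - l$1) * (u$2 - l$2)"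
    by (simp add: Basis_prod_def)
  also have "\<dots> = (\<Prod>b\<in>Basis. (u - l) \<bullet> b)"
    using ne by (simp add: B inner_axis)
  finally show "emeasure (distr lborel borel vec_of_pair) (box l u) = (\<Prod>b\<in>Basis. (u - l) \<bullet> b)" .
qed simp

lemma measure_seg_sum_axis:
  assumes A: "compact A" "convex A"
  shows "measure lebesgue (seg_sum (axis 1 1) A) = measure lebesgue A + measure lebesgue ((\<lambda>x. x $ 2) ` A)"
proof -
  define S where "S = (\<lambda>x::real^2. (x $ 1, x $ 2)) ` A"
  have lin: "linear (\<lambda>x::real^2. (x $ 1, x $ 2))" by (auto simp: linear_iff)
  have S: "compact S" "convex S" unfolding S_def
    by (intro compact_continuous_image A continuous_intros, intro convex_linear_image A lin)
  have e: "emeasure lborel X = emeasure lborel (vec_of_pair -` X)" if "compact X" for X :: "(real^2) set"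
    using that by (subst distr_vec_of_pair[symmetric], subst emeasure_distr) (auto intro: borel_compact)
  have m: "measure lebesgue X = measure lborel X" if "compact X" for X :: "'a::euclidean_space set"
    using that by (simp add: measure_completion borel_compact)
  have e2: "vec_of_pair (x $ 1, x $ 2) = x" for x by (simp add: vec_eq_iff forall_2)
  have 1: "vec_of_pair -` A = S"
    unfolding S_def using e2 by (force simp: image_iff)
  have 2: "vec_of_pair -` seg_sum (axis 1 1) A = {(s + x, y) | s x y. s \<in> {-1/2..1/2} \<and> (x, y) \<in> S}"
  proof (intro equalityI subsetI)
    fix p assume "p \<in> vec_of_pair -` seg_sum (axis 1 1) A"
    then obtain s a where sa: "vec_of_pair p = s *\<^sub>R axis 1 1 + a" "s \<in> {-1/2..1/2}" "a \<in> A"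
      by (auto simp: seg_sum_def)
    have "fst p = s + a $ 1" "snd p = a $ 2"
      using arg_cong[OF sa(1), of "\<lambda>x. x $ 1"] arg_cong[OF sa(1), of "\<lambda>x. x $ 2"] by (auto simp: axis_def)
    then show "p \<in> {(s + x, y) | s x y. s \<in> {-1/2..1/2} \<and> (x, y) \<in> S}"
      using sa unfolding S_def by (cases p) auto
  next
    fix p assume "p \<in> {(s + x, y) | s x y. s \<in> {-1/2..1/2} \<and> (x, y) \<in> S}"
    then obtain s a where "p = (s + a $ 1, a $ 2)" "s \<in> {-1/2..1/2}" "a \<in> A" by (auto simp: S_def)
    moreover from this have "vec_of_pair p = s *\<^sub>R axis 1 1 + a"
      by (simp add: vec_eq_iff forall_2 axis_def)
    ultimately show "p \<in> vec_of_pair -` seg_sum (axis 1 1) A"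
      by (auto simp: seg_sum_def)
  qed
  have sn: "snd ` S = (\<lambda>x. x $ 2) ` A" by (force simp: S_def)
  have cs: "compact (snd ` S)" by (intro compact_continuous_image S continuous_intros)
  have "emeasure lborel (seg_sum (axis 1 1) A) = emeasure lborel A + emeasure lborel (snd ` S)"
    using emeasure_horizontal_sum[OF S] by (simp add: e compact_seg_sum A 1 2)
  moreover have "emeasure lborel (seg_sum (axis 1 1) A) \<noteq> \<infinity>" "emeasure lborel A \<noteq> \<infinity>"
      "emeasure lborel (snd ` S) \<noteq> \<infinity>"
    using emeasure_compact_finite[OF compact_seg_sum[OF A(1)]] emeasure_compact_finite[OF A(1)]
      emeasure_compact_finite[OF cs] by (auto simp: less_top)
  ultimately have "measure lborel (seg_sum (axis 1 1) A) = measure lborel A + measure lborel (snd ` S)"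
    by (simp add: measure_def enn2real_plus less_top)
  then show ?thesis using cs by (simp add: m compact_seg_sum A sn)
qed

text \<open>The general case reduces to the axis by the unimodular map sending \<open>axis 1 1\<close> to \<open>v\<close>
  and \<open>axis 2 1\<close> to the quarter turn of \<open>v\<close> divided by its squared length.\<close>

lemma measure_seg_sum:
  assumes A: "compact A" "convex A"
  shows "measure lebesgue (seg_sum v A) = measure lebesgue A + measure lebesgue (det2 v ` A)"
proof (cases "v = 0")
  case True
  have "seg_sum 0 A = A" unfolding seg_sum_def by (auto intro!: exI[of _ 0])
  moreover have "det2 0 ` A \<subseteq> {0}" by (auto simp: det2_def)
  then have "measure lebesgue (det2 0 ` A) = 0"
    by (metis measure_eq_0_null_sets negligible_iff_null_sets negligible_sing negligible_subset)
  ultimately show ?thesis using True by simp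
next
  case False
  define q where "q = (v$1)\<^sup>2 + (v$2)\<^sup>2"
  have q: "q \<noteq> 0" using False by (auto simp: q_def vec_eq_iff forall_2 sum_power2_eq_zero_iff)
  define T :: "real^2 \<Rightarrow> real^2" where
    "T p = vector [p$1 * v$1 - p$2 * v$2 / q, p$1 * v$2 + p$2 * v$1 / q]" for p
  \<comment> \<open>The inverse of \<open>T\<close>. Its second coordinate is \<open>det2 v\<close>,
    so the vertical shadow of the transformed set is the image of \<open>A\<close> under
    \<open>det2 v\<close>.\<close>
  define T' :: "real^2 \<Rightarrow> real^2" where
    "T' p = vector [(p$1 * v$1 + p$2 * v$2) / q, v$1 * p$2 - v$2 * p$1]" for p
  have linT: "linear T" by (auto simp: linear_iff T_def vec_eq_iff forall_2 algebra_simps add_divide_distrib)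
  have linT': "linear T'" by (auto simp: linear_iff T'_def vec_eq_iff forall_2 algebra_simps add_divide_distrib)
  have inv: "T (T' p) = p" for p
  proof -
    have "(p$1 * v$1 + p$2 * v$2) * v$1 - (v$1 * p$2 - v$2 * p$1) * v$2 = q * p$1"
         "(p$1 * v$1 + p$2 * v$2) * v$2 + (v$1 * p$2 - v$2 * p$1) * v$1 = q * p$2"
      unfolding q_def by algebra+
    then show ?thesis using q unfolding T_def T'_def vec_eq_iff forall_2
      by (simp add: diff_divide_distrib[symmetric] add_divide_distrib[symmetric])
  qed
  have "det (matrix T) = (v$1 * v$1 + v$2 * v$2) / q"
    by (simp add: det_2 matrix_def T_def axis_def add_divide_distrib)
  then have det1: "det (matrix T) = 1" using q by (simp add: q_def power2_eq_square)
  define B where "B = T' ` A"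
  have B: "compact B" "convex B" unfolding B_def using A linT'
    by (simp_all add: compact_linear_image convex_linear_image)
  have TB: "T ` B = A" by (auto simp: B_def image_image inv)
  have "T (axis 1 1) = v" by (simp add: T_def axis_def vec_eq_iff forall_2)
  then have Tseg: "T ` seg_sum (axis 1 1) B = seg_sum v A"
    unfolding TB[symmetric] seg_sum_image
    by (force simp: linear_add[OF linT] linear_scale[OF linT] image_iff)
  have "(\<lambda>x. x $ 2) ` B = det2 v ` A"
    by (auto simp: B_def image_image T'_def det2_def)
  moreover have "measure lebesgue (T ` X) = measure lebesgue X" if "compact X" for X
    using measure_linear_image[OF linT lmeasurable_compact[OF that]] det1 by simp
  ultimately show ?thesis
    using measure_seg_sum_axis[OF B] B Tseg TB compact_seg_sum by metis
qed

text \<open>Twice the mixed area of the two zonotopes. In \<open>pair_area V V\<close> every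
  unordered pair of positions is counted twice.\<close>

definition pair_area :: "(real^2) list \<Rightarrow> (real^2) list \<Rightarrow> real" where
  "pair_area V W = (\<Sum>x\<leftarrow>V. \<Sum>y\<leftarrow>W. \<bar>det2 x y\<bar>)"

lemma sum_list_abs_nonneg: "0 \<le> (\<Sum>x\<leftarrow>V. \<bar>g x :: real\<bar>)"
  by (induction V) auto

lemma det2_swap: "\<bar>det2 x y\<bar> = \<bar>det2 y x\<bar>"
  by (simp add: det2_def abs_minus_commute mult.commute)

lemma pair_area_commute: "pair_area V W = pair_area W V"
proof -
  have "pair_area V (w # W) = (\<Sum>x\<leftarrow>V. \<bar>det2 w x\<bar>) + pair_area V W" for w W
    unfolding pair_area_def by (simp add: sum_list_addf det2_swap)
  then show ?thesis by (induction W) (simp_all add: pair_area_def)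
qed

lemma pair_area_append:
  "pair_area (V @ V') W = pair_area V W + pair_area V' W"
  "pair_area W (V @ V') = pair_area W V + pair_area W V'"
  by (simp_all add: pair_area_def sum_list_addf)

text \<open>Putting \<open>v\<close> in front adds the sum \<open>S\<close> of all |det2 v x| to the
  area but 2 * S to the double sum, since both orders count and the diagonal term vanishes. This is
  the source of the factor 1/2.\<close>

lemma measure_zonotope: "measure lebesgue (zonotope V) = pair_area V V / 2"
proof (induction V)
  case Nil
  then show ?case by (simp add: pair_area_def)
next
  case (Cons v V)
  define S where "S = (\<Sum>x\<leftarrow>V. \<bar>det2 v x\<bar>)"
  have S: "S \<ge> 0" unfolding S_def by (rule sum_list_abs_nonneg)
  have "pair_area (v # V) (v # V) = pair_area ([v] @ V) ([v] @ V)" by simp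
  also have "\<dots> = \<bar>det2 v v\<bar> + 2 * pair_area [v] V + pair_area V V"
    unfolding pair_area_append using pair_area_commute[of V "[v]"] by (simp add: pair_area_def)
  also have "\<dots> = 2 * S + pair_area V V" by (simp add: pair_area_def S_def det2_def)
  finally show ?case
    using measure_seg_sum[OF compact_zonotope convex_zonotope, of v V] Cons.IH S
    by (simp add: det2_zonotope zonotope_Cons S_def[symmetric])
qed

text \<open>Both diagonal blocks of the concatenated list give \<open>pair_area V V\<close>, as
  rotations preserve \<open>det2\<close>, and the two mixed blocks agree by symmetry. Halving leaves
  one of each.\<close>

lemma excluded_area_zonotope:
  "excluded_area t (zonotope V) = pair_area V V + pair_area V (map (rot t) V)"
proof -
  have "pair_area (map (rot t) V) (map (rot t) V) = pair_area V V"
    by (simp add: pair_area_def o_def det2_rot)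
  then show ?thesis unfolding excluded_area_def difference_rot_zonotope measure_zonotope pair_area_append
    using pair_area_commute[of V "map (rot t) V"] by simp
qed

section \<open>Zonoids\<close>


text \<open>\<open>B\<close> lies in the sum of \<open>A\<close> with a square of side 2 * d. The
  square is a sum of two segments, so the segment formula, applied twice, computes the added area
  from two shadows of lengths at most 4 * d * R and 4 * d * (R + d).\<close>

lemma measure_le_of_near:
  fixes A B :: "(real^2) set"
  assumes A: "compact A" "convex A" "A \<subseteq> cball 0 R" and B: "compact B"
    and R: "R \<ge> 0" and d: "d \<ge> 0" and near: "\<And>b. b \<in> B \<Longrightarrow> \<exists>a\<in>A. dist b a \<le> d"
  shows "measure lebesgue B \<le> measure lebesgue A + 8 * R * d + 4 * d\<^sup>2"
proof -
  define e1 e2 :: "real^2" where "e1 = (2 * d) *\<^sub>R axis 1 1" and "e2 = (2 * d) *\<^sub>R axis 2 1"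
  define S where "S = seg_sum e2 A"
  have e: "e1 $ 1 = 2 * d" "e1 $ 2 = 0" "e2 $ 1 = 0" "e2 $ 2 = 2 * d"
    by (simp_all add: e1_def e2_def axis_def)
  have S: "compact S" "convex S" unfolding S_def using A by (simp_all add: compact_seg_sum convex_seg_sum)
  have comp: "\<bar>x $ i\<bar> \<le> R" if "x \<in> A" for x i
    using that A(3) component_le_norm_cart[of x i] by (auto simp: subset_iff)
  have interval: "measure lebesgue X \<le> 2 * r" if "X \<subseteq> {-r..r}" "compact X" "r \<ge> 0" for X and r :: real
    using measure_mono_fmeasurable[OF that(1), of lebesgue] that(2,3) lmeasurable_compact[OF that(2)]
    by (auto simp: fmeasurableD)
  have det: "compact (det2 v ` X)" if "compact X" for v X
    using compact_linear_image[OF linear_det2 that] .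
  have "measure lebesgue (det2 e2 ` A) \<le> 2 * (2 * d * R)"
  proof (rule interval)
    show "det2 e2 ` A \<subseteq> {- (2 * d * R)..2 * d * R}"
    proof clarify
      fix x assume "x \<in> A"
      then have "\<bar>2 * d * x $ 1\<bar> \<le> 2 * d * R"
        unfolding abs_mult using comp d by (simp add: mult_left_mono)
      then show "det2 e2 x \<in> {- (2 * d * R)..2 * d * R}"
        by (auto simp: det2_def e abs_le_iff)
    qed
  qed (use det A R d in auto)
  moreover have "measure lebesgue (det2 e1 ` S) \<le> 2 * (2 * d * (R + d))"
  proof (rule interval)
    show "det2 e1 ` S \<subseteq> {- (2 * d * (R + d))..2 * d * (R + d)}"
    proof clarify
      fix y assume "y \<in> S"
      then obtain s x where y: "y = s *\<^sub>R e2 + x" "\<bar>s\<bar> \<le> 1/2" "x \<in> A"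
        by (auto simp: S_def seg_sum_def abs_le_iff)
      have "\<bar>y $ 2\<bar> \<le> \<bar>s * (2 * d)\<bar> + \<bar>x $ 2\<bar>" using y by (simp add: e abs_triangle_ineq)
      also have "\<bar>s * (2 * d)\<bar> \<le> d" using mult_right_mono[OF y(2), of "2 * d"] d by (simp add: abs_mult)
      finally have "\<bar>y $ 2\<bar> \<le> R + d" using comp[OF y(3), of 2] by linarith
      then have "\<bar>2 * d * y $ 2\<bar> \<le> 2 * d * (R + d)"
        unfolding abs_mult using d by (simp add: mult_left_mono)
      then show "det2 e1 y \<in> {- (2 * d * (R + d))..2 * d * (R + d)}"
        by (auto simp: det2_def e abs_le_iff)
    qed
  qed (use det S R d in auto)
  moreover have "measure lebesgue (seg_sum e1 S) =
      measure lebesgue A + measure lebesgue (det2 e2 ` A) + measure lebesgue (det2 e1 ` S)"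
    using measure_seg_sum[OF S] measure_seg_sum[OF A(1,2)] by (simp add: S_def)
  moreover have "measure lebesgue B \<le> measure lebesgue (seg_sum e1 S)"
  proof (rule measure_mono_fmeasurable)
    show "B \<subseteq> seg_sum e1 S"
    proof
      fix b assume "b \<in> B"
      then obtain a where a: "a \<in> A" "dist b a \<le> d" using near by blast
      have ab: "\<bar>b $ i - a $ i\<bar> \<le> d" for i
        using component_le_norm_cart[of "b - a" i] a(2) by (simp add: dist_norm)
      \<comment> \<open>For d = 0 the quotient is 0 by convention, which fits because
        \<open>ab\<close> then forces equal coordinates.\<close>
      define s where "s i = (b $ i - a $ i) / (2 * d)" for i
      have s: "s i \<in> {-1/2..1/2}" for i
        using ab[of i] d by (cases "d = 0") (auto simp: s_def field_simps abs_le_iff)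
      have s': "s i * (2 * d) = b $ i - a $ i" for i
        using ab[of i] d by (cases "d = 0") (auto simp: s_def)
      have "b = s 1 *\<^sub>R e1 + (s 2 *\<^sub>R e2 + a)"
        by (simp add: vec_eq_iff forall_2 e s')
      then show "b \<in> seg_sum e1 S" unfolding S_def seg_sum_def using s a(1) by blast
    qed
  qed (use S B in \<open>auto intro!: lmeasurable_compact compact_seg_sum fmeasurableD\<close>)
  ultimately show ?thesis by (simp add: algebra_simps power2_eq_square)
qed

text \<open>Compactness makes the supremum a true upper bound and lets the infimal distance be
  attained, so a bound on the metric yields actual nearby points.\<close>

lemma hausdorff_distD:
  fixes S T :: "'a::heine_borel set"
  assumes "compact S" "compact T" "T \<noteq> {}" "hausdorff_dist S T \<le> d" "x \<in> S"
  shows "\<exists>y\<in>T. dist x y \<le> d"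
proof -
  have "compact ((\<lambda>x. infdist x T) ` S)"
    using assms by (intro compact_continuous_image continuous_intros)
  then have "bdd_above ((\<lambda>x. infdist x T) ` S)" by (intro bounded_imp_bdd_above compact_imp_bounded)
  then have "infdist x T \<le> (SUP x\<in>S. infdist x T)" using assms(5) by (intro cSUP_upper)
  then have "infdist x T \<le> d" using assms(4) by (simp add: hausdorff_dist_def)
  then show ?thesis using infdist_attains_inf[OF compact_imp_closed[OF assms(2)] assms(3), of x]
    by metis
qed

lemma hausdorff_dist_commute: "hausdorff_dist S T = hausdorff_dist T S"
  by (simp add: hausdorff_dist_def max.commute)

lemma zonoid_near_zonotope:
  assumes "zonoid K" "e > 0"
  obtains V where "\<And>x. x \<in> K \<Longrightarrow> \<exists>y\<in>zonotope V. dist x y \<le> e"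
    "\<And>y. y \<in> zonotope V \<Longrightarrow> \<exists>x\<in>K. dist y x \<le> e"
proof -
  obtain V where "(\<lambda>n. hausdorff_dist (zonotope (V n)) K) \<longlonglongrightarrow> 0"
    and K: "compact K" "K \<noteq> {}" using assms(1) by (auto simp: zonoid_def)
  then have "\<forall>\<^sub>F n in sequentially. hausdorff_dist (zonotope (V n)) K < e"
    using assms(2) by (intro order_tendstoD) auto
  then obtain n where n: "hausdorff_dist (zonotope (V n)) K \<le> e"
    by (auto simp: eventually_sequentially intro: less_imp_le)
  have ne: "zonotope (V n) \<noteq> {}" using zero_in_zonotope by blast
  show thesis
    using that[of "V n"] hausdorff_distD[OF compact_zonotope K n]
      hausdorff_distD[OF K(1) compact_zonotope ne n[unfolded hausdorff_dist_commute[of _ K]]]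
    by blast
qed

text \<open>A Hausdorff limit of convex sets is convex: the two points are moved into a nearby
  zonotope, combined there, and the result is moved back. The area comparison with \<open>K\<close>
  in the role of the convex set relies on it.\<close>

lemma convex_zonoid:
  assumes "zonoid K"
  shows "convex K"
  unfolding convex_def
proof clarify
  fix x y and u v :: real
  assume xy: "x \<in> K" "y \<in> K" and uv: "0 \<le> u" "0 \<le> v" "u + v = 1"
  have K: "closed K" "K \<noteq> {}" using assms by (auto simp: zonoid_def compact_imp_closed)
  let ?p = "u *\<^sub>R x + v *\<^sub>R y"
  have "infdist ?p K \<le> 0 + e" if e: "e > 0" for e
  proof -
    obtain V where V: "\<And>x. x \<in> K \<Longrightarrow> \<exists>y\<in>zonotope V. dist x y \<le> e / 2"
      "\<And>y. y \<in> zonotope V \<Longrightarrow> \<exists>x\<in>K. dist y x \<le> e / 2"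
      using zonoid_near_zonotope[OF assms, of "e / 2"] e by auto
    obtain x' y' where *: "x' \<in> zonotope V" "dist x x' \<le> e / 2" "y' \<in> zonotope V" "dist y y' \<le> e / 2"
      using V(1) xy by metis
    let ?p' = "u *\<^sub>R x' + v *\<^sub>R y'"
    have "?p' \<in> zonotope V" using convexD[OF convex_zonotope *(1,3) uv] .
    then obtain q where q: "q \<in> K" "dist ?p' q \<le> e / 2" using V(2) by blast
    have "?p - ?p' = u *\<^sub>R (x - x') + v *\<^sub>R (y - y')" by (simp add: algebra_simps)
    then have "dist ?p ?p' \<le> u * dist x x' + v * dist y y'"
      using uv norm_triangle_ineq[of "u *\<^sub>R (x - x')" "v *\<^sub>R (y - y')"] by (simp add: dist_norm)
    also have "\<dots> \<le> u * (e / 2) + v * (e / 2)" using * uv by (intro add_mono mult_left_mono) auto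
    also have "\<dots> = e / 2" using uv(3) by (simp add: distrib_right[symmetric])
    finally have "dist ?p q \<le> e" using q(2) dist_triangle[of ?p q ?p'] by linarith
    then show ?thesis using infdist_le[OF q(1), of ?p] by simp
  qed
  then have "infdist ?p K \<le> 0" by (rule field_le_epsilon)
  then show "?p \<in> K" using K in_closed_iff_infdist_zero[OF K] infdist_nonneg[of ?p K] by simp
qed

section \<open>The difference of a set and its rotated copy\<close>

definition rot_difference :: "real \<Rightarrow> (real^2) set \<Rightarrow> (real^2) set" where
  "rot_difference t K = {a - b | a b. a \<in> K \<and> b \<in> rot t ` K}"

lemma rot_difference_image: "rot_difference t K = (\<lambda>(a, b). a - rot t b) ` (K \<times> K)"
  by (force simp: rot_difference_def)

lemma linear_rot_difference: "linear (\<lambda>(a, b). a - rot t b)"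
  by (auto simp: linear_iff linear_add[OF linear_rot] linear_scale[OF linear_rot] algebra_simps)

lemma compact_rot_difference: "compact K \<Longrightarrow> compact (rot_difference t K)"
  unfolding rot_difference_image
  by (intro compact_linear_image compact_Times linear_rot_difference)

lemma convex_rot_difference: "convex K \<Longrightarrow> convex (rot_difference t K)"
  unfolding rot_difference_image
  by (intro convex_linear_image convex_Times linear_rot_difference)

lemma rot_difference_subset_cball:
  assumes "K \<subseteq> cball 0 R"
  shows "rot_difference t K \<subseteq> cball 0 (2 * R)"
proof -
  have "norm (a - rot t b) \<le> 2 * R" if "a \<in> K" "b \<in> K" for a b
  proof -
    have "norm a \<le> R" "norm b \<le> R" using that assms by auto
    then show ?thesis using norm_triangle_ineq4[of a "rot t b"] norm_rot[of t b] by linarith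
  qed
  then show ?thesis by (auto simp: rot_difference_image)
qed

text \<open>Rotations are isometries, so the loss factor 2 is the same for all angles; this gives
  uniformity in \<open>t\<close>.\<close>

lemma rot_difference_near:
  assumes "\<And>x. x \<in> A \<Longrightarrow> \<exists>y\<in>B. dist x y \<le> d" "p \<in> rot_difference t A"
  shows "\<exists>q\<in>rot_difference t B. dist p q \<le> 2 * d"
proof -
  obtain a b where p: "p = a - rot t b" "a \<in> A" "b \<in> A"
    using assms(2) by (auto simp: rot_difference_def)
  then obtain a' b' where *: "a' \<in> B" "b' \<in> B" "dist a a' \<le> d" "dist b b' \<le> d"
    using assms(1) by meson
  have "p - (a' - rot t b') = (a - a') - rot t (b - b')"
    unfolding p(1) linear_diff[OF linear_rot] by simp
  then have "dist p (a' - rot t b') \<le> dist a a' + dist b b'"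
    using norm_triangle_ineq4[of "a - a'" "rot t (b - b')"] unfolding dist_norm by (simp only: norm_rot)
  then show ?thesis using * by (intro bexI[of _ "a' - rot t b'"]) (auto simp: rot_difference_def)
qed

lemma excluded_area_rot_difference: "excluded_area t K = measure lebesgue (rot_difference t K)"
  by (simp add: excluded_area_def rot_difference_def)

lemma excluded_area_zonoid_approx:
  assumes "zonoid K" "e > 0"
  obtains V where "\<And>t. \<bar>excluded_area t (zonotope V) - excluded_area t K\<bar> \<le> e"
proof -
  have K: "compact K" using assms(1) by (simp add: zonoid_def)
  obtain R where R: "R \<ge> 0" "K \<subseteq> cball 0 R"
    using compact_imp_bounded[OF K] unfolding bounded_pos by (metis less_imp_le mem_cball_0 subsetI)
  \<comment> \<open>Both sets lie in the ball of radius R + 1, hence their differences in that of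
    radius 2 * (R + 1), at distance 2 * d. The comparison costs 32 * (R + 1) * d + 16 * d^2, at most
    (32 * R + 48) * d once d is at most 1.\<close>
  define d where "d = min 1 (e / (32 * R + 48))"
  have d: "0 < d" "d \<le> 1" using assms(2) R(1) by (auto simp: d_def)
  have "d \<le> e / (32 * R + 48)" by (simp add: d_def)
  then have de: "(32 * R + 48) * d \<le> e" using R(1) by (simp add: field_simps)
  obtain V where V: "\<And>x. x \<in> K \<Longrightarrow> \<exists>y\<in>zonotope V. dist x y \<le> d"
    "\<And>y. y \<in> zonotope V \<Longrightarrow> \<exists>x\<in>K. dist y x \<le> d"
    using zonoid_near_zonotope[OF assms(1) d(1)] by blast
  have K': "K \<subseteq> cball 0 (R + 1)" using R(2) by auto
  have Z': "zonotope V \<subseteq> cball 0 (R + 1)"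
  proof
    fix y assume "y \<in> zonotope V"
    then obtain x where "x \<in> K" "dist y x \<le> d" using V(2) by blast
    then have "norm y \<le> d + R"
      using R(2) norm_triangle_ineq2[of y x] by (force simp: dist_norm)
    then show "y \<in> cball 0 (R + 1)" using d(2) by simp
  qed
  have dd: "d * d \<le> d" using d by (simp add: mult_left_le)
  have le: "excluded_area t B \<le> excluded_area t A + e"
    if AB: "compact A" "convex A" "A \<subseteq> cball 0 (R + 1)" "compact B"
      "\<forall>x\<in>B. \<exists>y\<in>A. dist x y \<le> d" for A B t
  proof -
    have "excluded_area t B \<le> excluded_area t A + 8 * (2 * (R + 1)) * (2 * d) + 4 * (2 * d)\<^sup>2"
      unfolding excluded_area_rot_difference
      using AB R(1) d(1) rot_difference_near[of B A d]
      by (intro measure_le_of_near compact_rot_difference convex_rot_difference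
          rot_difference_subset_cball) auto
    moreover have "8 * (2 * (R + 1)) * (2 * d) + 4 * (2 * d)\<^sup>2 \<le> (32 * R + 48) * d"
      using dd by (simp add: algebra_simps power2_eq_square)
    ultimately show ?thesis using de by linarith
  qed
  have "\<bar>excluded_area t (zonotope V) - excluded_area t K\<bar> \<le> e" for t
    using le[OF K convex_zonoid[OF assms(1)] K' compact_zonotope[of V], of t] V
      le[OF compact_zonotope convex_zonotope Z' K, of t] by (simp add: abs_le_iff)
  then show thesis by (rule that)
qed

section \<open>Even Fourier modes\<close>


lemma integrable_on_cont: "continuous_on UNIV g \<Longrightarrow> (g :: real \<Rightarrow> real) integrable_on {a..b}"
  by (rule integrable_continuous_real[OF continuous_on_subset[OF _ subset_UNIV]])

text \<open>Passes from the Lebesgue integral over the open interval to the gauge integral over the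
  closed one, where the fundamental theorem of calculus is at hand.\<close>

lemma l2_inner_eq_integral:
  assumes "continuous_on UNIV g" "continuous_on UNIV h"
  shows "l2_inner g h = integral {0..2*pi} (\<lambda>t. g t * h t)"
proof -
  have "(\<lambda>t. g t * h t) absolutely_integrable_on {0..2*pi}"
    using absolutely_integrable_continuous_real[of 0 "2*pi" "\<lambda>t. g t * h t"] assms
    by (auto intro!: continuous_intros intro: continuous_on_subset)
  then have "set_integrable lebesgue {0<..<2*pi} (\<lambda>t. g t * h t)"
    by (rule set_integrable_subset) auto
  then show ?thesis unfolding l2_inner_def
    by (simp add: set_lebesgue_integral_eq_integral integral_open_interval_real)
qed

lemma l2_inner_commute: "l2_inner g h = l2_inner h g"
  by (simp add: l2_inner_def mult.commute)

lemma l2_inner_add_left: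
  assumes "continuous_on UNIV g" "continuous_on UNIV g'" "continuous_on UNIV h"
  shows "l2_inner (\<lambda>t. g t + g' t) h = l2_inner g h + l2_inner g' h"
  using assms
  by (simp add: l2_inner_eq_integral continuous_on_add continuous_on_mult distrib_right
      integrable_on_cont integral_add)

lemma l2_inner_diff_left:
  assumes "continuous_on UNIV g" "continuous_on UNIV g'" "continuous_on UNIV h"
  shows "l2_inner (\<lambda>t. g t - g' t) h = l2_inner g h - l2_inner g' h"
  using assms
  by (simp add: l2_inner_eq_integral continuous_on_diff continuous_on_mult left_diff_distrib
      integrable_on_cont integral_diff)

lemma l2_inner_scale_left: "l2_inner (\<lambda>t. c * g t) h = c * l2_inner g h"
  by (simp add: l2_inner_def mult.assoc)

lemma l2_inner_sum_left:
  assumes "\<And>i. i \<in> I \<Longrightarrow> continuous_on UNIV (g i)" "continuous_on UNIV h" "finite I"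
  shows "l2_inner (\<lambda>t. \<Sum>i\<in>I. g i t) h = (\<Sum>i\<in>I. l2_inner (g i) h)"
  using assms(3,1)
proof (induction I)
  case empty
  then show ?case by (simp add: l2_inner_def)
next
  case (insert i I)
  then show ?case using assms(2)
    by (simp add: l2_inner_add_left[of "g i" "\<lambda>t. \<Sum>i\<in>I. g i t" h] continuous_on_sum)
qed

lemma l2_inner_self_nonneg: "continuous_on UNIV g \<Longrightarrow> 0 \<le> l2_inner g g"
  by (simp add: l2_inner_eq_integral integral_nonneg integrable_on_cont continuous_on_mult)

lemma l2_norm_sq: "continuous_on UNIV g \<Longrightarrow> (l2_norm g)\<^sup>2 = l2_inner g g"
  by (simp add: l2_norm_def l2_inner_self_nonneg)

lemma l2_inner_self_mono:
  assumes "continuous_on UNIV g" "continuous_on UNIV h" "\<And>t. (g t)\<^sup>2 \<le> h t"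
  shows "l2_inner g g \<le> integral {0..2*pi} h"
  using assms
  by (auto simp: l2_inner_eq_integral power2_eq_square
      intro!: integral_le integrable_on_cont continuous_on_mult)

lemma l2_inner_self_le_bound:
  assumes "continuous_on UNIV g" "\<And>t. \<bar>g t\<bar> \<le> B"
  shows "l2_inner g g \<le> 2 * pi * B\<^sup>2"
proof -
  have "(g t)\<^sup>2 \<le> B\<^sup>2" for t using power_mono[OF assms(2)[of t], of 2] by simp
  then show ?thesis using l2_inner_self_mono[OF assms(1), of "\<lambda>t. B\<^sup>2"] by simp
qed

lemma l2_inner_self_add3:
  assumes "continuous_on UNIV a" "continuous_on UNIV b" "continuous_on UNIV c"
  shows "l2_inner (\<lambda>t. a t + b t + c t) (\<lambda>t. a t + b t + c t) \<le>
    3 * (l2_inner a a + l2_inner b b + l2_inner c c)"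
proof -
  have sq: "(x + y + z)\<^sup>2 \<le> 3 * (x * x + y * y + z * z)" for x y z :: real
  proof -
    have "0 \<le> (x - y)\<^sup>2 + (y - z)\<^sup>2 + (x - z)\<^sup>2" by simp
    then show ?thesis by (simp add: power2_eq_square algebra_simps)
  qed
  have "l2_inner (\<lambda>t. a t + b t + c t) (\<lambda>t. a t + b t + c t) \<le>
      integral {0..2*pi} (\<lambda>t. 3 * (a t * a t + b t * b t + c t * c t))"
    using assms sq by (intro l2_inner_self_mono continuous_intros) auto
  also have "\<dots> = 3 * (l2_inner a a + l2_inner b b + l2_inner c c)"
    using assms
    by (simp add: l2_inner_eq_integral integral_add integrable_on_cont continuous_on_mult continuous_on_add
        del: distrib_left_numeral)
  finally show ?thesis .
qed

section \<open>Orthogonality of the cosines and the projection onto their span\<close>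

lemma integral_cos_int:
  "integral {0..2*pi} (\<lambda>t. cos (of_int k * t)) = (if k = 0 then 2 * pi else 0)"
proof (cases "k = 0")
  case False
  have "((\<lambda>t. cos (of_int k * t)) has_integral
      (sin (of_int k * (2*pi)) / of_int k - sin (of_int k * 0) / of_int k)) {0..2*pi}"
    using False
    by (intro fundamental_theorem_of_calculus)
       (auto intro!: derivative_eq_intros simp: has_real_derivative_iff_has_vector_derivative[symmetric])
  moreover have "sin (of_int k * (2*pi)) = 0"
    using sin_int_2pin[of k] by (simp add: mult.commute)
  ultimately show ?thesis using False by (simp add: integral_unique)
qed simp

definition emode :: "nat \<Rightarrow> real \<Rightarrow> real" where
  "emode m t = cos (2 * real m * t)"

lemma continuous_emode [continuous_intros]: "continuous_on S (emode m)"
  unfolding emode_def by (intro continuous_intros)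

text \<open>Squared norm of \<open>emode m\<close>; the constant mode is the exceptional
  one.\<close>

definition emode_sq :: "nat \<Rightarrow> real" where
  "emode_sq m = (if m = 0 then 2 * pi else pi)"

lemma emode_sq_pos: "emode_sq m > 0"
  by (simp add: emode_sq_def)

lemma l2_inner_emode: "l2_inner (emode m) (emode n) = (if m = n then emode_sq m else 0)"
proof -
  let ?k = "2 * int m - 2 * int n" and ?l = "2 * int m + 2 * int n"
  have eq: "emode m t * emode n t = (1/2) * (cos (of_int ?k * t) + cos (of_int ?l * t))" for t
    unfolding emode_def using cos_times_cos[of "2 * real m * t" "2 * real n * t"]
    by (simp add: algebra_simps)
  have "l2_inner (emode m) (emode n) = integral {0..2*pi} (\<lambda>t. (1/2) * (cos (of_int ?k * t) + cos (of_int ?l * t)))"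
    by (simp add: l2_inner_eq_integral continuous_emode eq del: of_int_diff of_int_add of_int_mult)
  also have "\<dots> = (1/2) * (integral {0..2*pi} (\<lambda>t. cos (of_int ?k * t)) + integral {0..2*pi} (\<lambda>t. cos (of_int ?l * t)))"
    unfolding integral_mult_right
    by (subst integral_add) (auto intro!: integrable_on_cont continuous_intros)
  also have "\<dots> = (if m = n then emode_sq m else 0)"
    unfolding integral_cos_int by (auto simp: emode_sq_def)
  finally show ?thesis .
qed

lemma even_modes_iff: "p \<in> even_modes M \<longleftrightarrow> (\<exists>c. p = (\<lambda>t. \<Sum>m\<le>M. c m * emode m t))"
  by (auto simp: even_modes_def emode_def)

lemma continuous_even_modes: "p \<in> even_modes M \<Longrightarrow> continuous_on UNIV p"
  by (auto simp: even_modes_iff intro!: continuous_intros)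

lemma even_modes_diff:
  assumes "p \<in> even_modes M" "q \<in> even_modes M"
  shows "(\<lambda>t. p t - q t) \<in> even_modes M"
proof -
  obtain c d where "p = (\<lambda>t. \<Sum>m\<le>M. c m * emode m t)" "q = (\<lambda>t. \<Sum>m\<le>M. d m * emode m t)"
    using assms by (auto simp: even_modes_iff)
  then show ?thesis unfolding even_modes_iff
    by (intro exI[of _ "\<lambda>m. c m - d m"]) (auto simp: sum_subtractf left_diff_distrib)
qed

lemma emode_in_even_modes: "m \<le> M \<Longrightarrow> emode m \<in> even_modes M"
  unfolding even_modes_iff
  by (intro exI[of _ "\<lambda>n. if n = m then 1 else 0"]) (auto simp: fun_eq_iff if_distrib[of "\<lambda>c. c * _"] cong: if_cong)

lemma const_in_even_modes: "(\<lambda>t. a) \<in> even_modes M"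
  unfolding even_modes_iff
  by (intro exI[of _ "\<lambda>n. if n = 0 then a else 0"])
     (auto simp: fun_eq_iff emode_def if_distrib[of "\<lambda>c. c * _"] cong: if_cong)

lemma l2_inner_modes_emode:
  assumes "n \<le> M"
  shows "l2_inner (\<lambda>t. \<Sum>m\<le>M. c m * emode m t) (emode n) = c n * emode_sq n"
proof -
  have "l2_inner (\<lambda>t. \<Sum>m\<le>M. c m * emode m t) (emode n) = (\<Sum>m\<le>M. c m * (if m = n then emode_sq m else 0))"
    by (subst l2_inner_sum_left) (auto intro!: continuous_intros simp: l2_inner_scale_left l2_inner_emode)
  also have "\<dots> = c n * emode_sq n" using assms
    by (simp add: if_distrib[of "\<lambda>x. _ * x"] cong: if_cong)
  finally show ?thesis .
qed

definition emode_coeff :: "(real \<Rightarrow> real) \<Rightarrow> nat \<Rightarrow> real" where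
  "emode_coeff g m = l2_inner g (emode m) / emode_sq m"

text \<open>Truncated cosine series: the explicit form of the projection, which
  \<open>modes_proj\<close> gives only as a definite description.\<close>

definition emode_sum :: "nat \<Rightarrow> (real \<Rightarrow> real) \<Rightarrow> real \<Rightarrow> real" where
  "emode_sum M g t = (\<Sum>m\<le>M. emode_coeff g m * emode m t)"

lemma emode_sum_even_modes: "emode_sum M g \<in> even_modes M"
  unfolding even_modes_iff emode_sum_def by blast

lemma emode_sum_orthogonal:
  assumes g: "continuous_on UNIV g" and h: "h \<in> even_modes M"
  shows "l2_inner (\<lambda>t. g t - emode_sum M g t) h = 0"
proof -
  obtain d where d: "h = (\<lambda>t. \<Sum>m\<le>M. d m * emode m t)" using h by (auto simp: even_modes_iff)
  have c: "continuous_on UNIV (emode_sum M g)" by (rule continuous_even_modes[OF emode_sum_even_modes])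
  have "l2_inner (\<lambda>t. g t - emode_sum M g t) (emode n) = 0" if "n \<le> M" for n
    using emode_sq_pos[of n] l2_inner_modes_emode[OF that, of "emode_coeff g"] g c
    by (simp add: l2_inner_diff_left continuous_emode emode_sum_def[abs_def] emode_coeff_def)
  then have "(\<Sum>m\<le>M. d m * l2_inner (emode m) (\<lambda>t. g t - emode_sum M g t)) = 0"
    by (intro sum.neutral) (auto simp: l2_inner_commute[of "emode _"])
  moreover have "l2_inner h (\<lambda>t. g t - emode_sum M g t) = (\<Sum>m\<le>M. d m * l2_inner (emode m) (\<lambda>t. g t - emode_sum M g t))"
    unfolding d using g c
    by (subst l2_inner_sum_left) (auto intro!: continuous_intros simp: l2_inner_scale_left)
  ultimately show ?thesis by (simp add: l2_inner_commute)
qed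

text \<open>Orthogonality of the residual to \<open>emode n\<close> determines the coefficient of
  index \<open>n\<close>, so only one cosine polynomial fits the description.\<close>

lemma modes_proj_eq:
  assumes g: "continuous_on UNIV g"
  shows "modes_proj M g = emode_sum M g"
  unfolding modes_proj_def
proof (rule the_equality)
  show "emode_sum M g \<in> even_modes M \<and> (\<forall>h\<in>even_modes M. l2_inner (\<lambda>t. g t - emode_sum M g t) h = 0)"
    using emode_sum_even_modes emode_sum_orthogonal[OF g] by blast
next
  fix p assume p: "p \<in> even_modes M \<and> (\<forall>h\<in>even_modes M. l2_inner (\<lambda>t. g t - p t) h = 0)"
  then obtain c where c: "p = (\<lambda>t. \<Sum>m\<le>M. c m * emode m t)" by (auto simp: even_modes_iff)
  have "c n = emode_coeff g n" if n: "n \<le> M" for n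
  proof -
    have "l2_inner (\<lambda>t. g t - p t) (emode n) = 0" using p emode_in_even_modes[OF n] by blast
    then have "l2_inner g (emode n) = c n * emode_sq n"
      using l2_inner_modes_emode[OF n, of c] g continuous_even_modes[of p M] p
      by (simp add: l2_inner_diff_left continuous_emode c)
    then show ?thesis using emode_sq_pos[of n] by (simp add: emode_coeff_def)
  qed
  then show "p = emode_sum M g" by (auto simp: c emode_sum_def[abs_def])
qed

text \<open>The residual is orthogonal to the span, which contains the difference of the projection
  and \<open>h\<close>. Leaving \<open>h\<close> arbitrary serves twice: h = 0 splits the norm, and
  dropping the second term gives best approximation.\<close>

lemma modes_proj_pythagoras:
  assumes g: "continuous_on UNIV g" and h: "h \<in> even_modes M"
  shows "l2_inner (\<lambda>t. g t - h t) (\<lambda>t. g t - h t) =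
    l2_inner (\<lambda>t. g t - modes_proj M g t) (\<lambda>t. g t - modes_proj M g t) +
    l2_inner (\<lambda>t. modes_proj M g t - h t) (\<lambda>t. modes_proj M g t - h t)"
proof -
  define p where "p = modes_proj M g"
  have pm: "p \<in> even_modes M" using emode_sum_even_modes by (simp add: p_def modes_proj_eq[OF g])
  have ch: "continuous_on UNIV h" and cp: "continuous_on UNIV p"
    using h pm by (auto intro: continuous_even_modes)
  have orth: "l2_inner (\<lambda>t. g t - p t) (\<lambda>t. p t - h t) = 0"
    using emode_sum_orthogonal[OF g even_modes_diff[OF pm h]] by (simp add: p_def modes_proj_eq[OF g])
  let ?a = "\<lambda>t. g t - p t" and ?b = "\<lambda>t. p t - h t"
  have ca: "continuous_on UNIV ?a" "continuous_on UNIV ?b" using g cp ch by (auto intro!: continuous_intros)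
  have eq: "(\<lambda>t. g t - h t) = (\<lambda>t. ?a t + ?b t)" by auto
  have cs: "continuous_on UNIV (\<lambda>t. ?a t + ?b t)" using ca by (rule continuous_on_add)
  have "l2_inner (\<lambda>t. ?a t + ?b t) (\<lambda>t. ?a t + ?b t) = l2_inner ?a (\<lambda>t. ?a t + ?b t) + l2_inner ?b (\<lambda>t. ?a t + ?b t)"
    by (rule l2_inner_add_left[OF ca cs])
  also have "l2_inner ?a (\<lambda>t. ?a t + ?b t) = l2_inner ?a ?a + l2_inner ?b ?a"
    by (subst l2_inner_commute) (rule l2_inner_add_left[OF ca ca(1)])
  also have "l2_inner ?b (\<lambda>t. ?a t + ?b t) = l2_inner ?a ?b + l2_inner ?b ?b"
    by (subst l2_inner_commute) (rule l2_inner_add_left[OF ca ca(2)])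
  finally show ?thesis unfolding p_def[symmetric] eq using orth by (simp add: l2_inner_commute)
qed

lemma modes_proj_best:
  assumes g: "continuous_on UNIV g" and h: "h \<in> even_modes M"
  shows "l2_inner (\<lambda>t. g t - modes_proj M g t) (\<lambda>t. g t - modes_proj M g t) \<le>
    l2_inner (\<lambda>t. g t - h t) (\<lambda>t. g t - h t)"
proof -
  have "continuous_on UNIV (\<lambda>t. modes_proj M g t - h t)"
    using continuous_even_modes[OF h] continuous_even_modes[OF emode_sum_even_modes]
    by (auto simp: modes_proj_eq[OF g] intro!: continuous_on_diff)
  then show ?thesis unfolding modes_proj_pythagoras[OF g h] using l2_inner_self_nonneg by force
qed

lemma continuous_modes_proj: "continuous_on UNIV g \<Longrightarrow> continuous_on UNIV (modes_proj M g)"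
  using continuous_even_modes[OF emode_sum_even_modes] by (simp add: modes_proj_eq)

lemma modes_proj_norm:
  assumes g: "continuous_on UNIV g"
  shows "l2_inner g g = l2_inner (\<lambda>t. g t - modes_proj M g t) (\<lambda>t. g t - modes_proj M g t) +
    (l2_norm (modes_proj M g))\<^sup>2"
  using modes_proj_pythagoras[OF g const_in_even_modes[of 0 M]]
  by (simp add: l2_norm_sq continuous_modes_proj g)

lemma modes_proj_norm_le:
  assumes g: "continuous_on UNIV g"
  shows "(l2_norm (modes_proj M g))\<^sup>2 \<le> l2_inner g g"
  using modes_proj_norm[OF g, of M]
    l2_inner_self_nonneg[of "\<lambda>t. g t - modes_proj M g t"] g continuous_modes_proj[OF g]
  by (simp add: continuous_on_diff)

text \<open>Constants lie in the span, so the projection keeps the mean of \<open>g\<close>;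
  Cauchy-Schwarz against 1 does the rest. This is how a bound inside the modes reaches the
  mean.\<close>

lemma integral_le_modes_proj_norm:
  assumes g: "continuous_on UNIV g"
  shows "(integral {0..2*pi} g)\<^sup>2 \<le> 2 * pi * (l2_norm (modes_proj M g))\<^sup>2"
proof -
  define p where "p = modes_proj M g"
  have cp: "continuous_on UNIV p" unfolding p_def by (rule continuous_modes_proj[OF g])
  define J a where "J = integral {0..2*pi} g" and "a = J / (2 * pi)"
  have "l2_inner (\<lambda>t. g t - p t) (\<lambda>t. 1) = 0"
    using emode_sum_orthogonal[OF g const_in_even_modes[of 1 M]] by (simp add: p_def modes_proj_eq[OF g])
  then have "l2_inner p (\<lambda>t. 1) = l2_inner g (\<lambda>t. 1)"
    using l2_inner_diff_left[OF g cp, of "\<lambda>t. 1"] by simp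
  then have J: "integral {0..2*pi} p = J"
    using g cp by (simp add: l2_inner_eq_integral J_def)
  \<comment> \<open>Cauchy-Schwarz in the form of a nonnegative variance about the mean
    \<open>a\<close>.\<close>
  have "0 \<le> l2_inner (\<lambda>t. p t - a) (\<lambda>t. p t - a)"
    using cp by (intro l2_inner_self_nonneg continuous_intros)
  also have "\<dots> = integral {0..2*pi} (\<lambda>t. (p t * p t - 2 * a * p t) + a * a)"
    using cp by (subst l2_inner_eq_integral) (auto intro!: continuous_intros integral_cong simp: algebra_simps)
  also have "\<dots> = l2_inner p p - 2 * a * J + 2 * pi * (a * a)"
    using cp by (simp add: integral_add integral_diff integrable_on_cont continuous_on_mult continuous_on_diff
        l2_inner_eq_integral J)
  also have "\<dots> = l2_inner p p - J\<^sup>2 / (2 * pi)"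
    by (simp add: a_def power2_eq_square field_simps)
  finally have "J\<^sup>2 \<le> 2 * pi * l2_inner p p" by (simp add: field_simps)
  then show ?thesis using l2_norm_sq[OF cp] by (simp add: J_def p_def)
qed

section \<open>The Fourier series of the absolute sine\<close>


text \<open>An antiderivative \<open>P\<close> gains the same amount over every interval of length 2
  * pi, because P (x + 2 * pi) - P x has derivative zero by periodicity.\<close>

lemma integral_periodic_shift:
  fixes F :: "real \<Rightarrow> real"
  assumes F: "continuous_on UNIV F" and per: "\<And>t. F (t + 2 * pi) = F t"
  shows "integral {0..2*pi} (\<lambda>t. F (t + a)) = integral {0..2*pi} F"
proof -
  \<comment> \<open>Wide enough to contain every interval of length 2 * pi that starts at a point of
    absolute value at most |a|.\<close>
  define R where "R = \<bar>a\<bar> + 2 * pi"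
  obtain P where P: "\<And>x. x \<in> {-R..R} \<Longrightarrow> (P has_vector_derivative F x) (at x within {-R..R})"
    using antiderivative_continuous[OF continuous_on_subset[OF F subset_UNIV]] by metis
  have P': "(P has_real_derivative F x) (at x within S)" if "S \<subseteq> {-R..R}" "x \<in> S" for x S
    using has_vector_derivative_within_subset[OF P that(1)] that
    by (auto simp: has_real_derivative_iff_has_vector_derivative)
  have int: "integral {0..2*pi} (\<lambda>t. F (t + b)) = P (b + 2 * pi) - P b" if "\<bar>b\<bar> \<le> \<bar>a\<bar>" for b
  proof (rule integral_unique)
    have "((\<lambda>t. F (t + b)) has_integral (P (2 * pi + b) - P (0 + b))) {0..2*pi}"
    proof (rule fundamental_theorem_of_calculus)
      fix x assume x: "x \<in> {0..2*pi}"
      have "((P \<circ> (\<lambda>t. t + b)) has_real_derivative F (x + b) * 1) (at x within {0..2*pi})"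
        using x that by (intro DERIV_image_chain P') (auto simp: R_def intro!: derivative_eq_intros)
      then show "((\<lambda>t. P (t + b)) has_vector_derivative F (x + b)) (at x within {0..2*pi})"
        by (simp add: has_real_derivative_iff_has_vector_derivative o_def)
    qed simp
    then show "((\<lambda>t. F (t + b)) has_integral (P (b + 2 * pi) - P b)) {0..2*pi}" by (simp add: add.commute)
  qed
  have "\<exists>c. \<forall>x\<in>{-\<bar>a\<bar>..\<bar>a\<bar>}. P (x + 2 * pi) - P x = c"
  proof (rule has_field_derivative_zero_constant)
    fix x assume x: "x \<in> {-\<bar>a\<bar>..\<bar>a\<bar>}"
    have "((P \<circ> (\<lambda>t. t + 2 * pi)) has_real_derivative F (x + 2 * pi) * 1) (at x within {-\<bar>a\<bar>..\<bar>a\<bar>})"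
      using x by (intro DERIV_image_chain P') (auto simp: R_def intro!: derivative_eq_intros)
    moreover have "(P has_real_derivative F x) (at x within {-\<bar>a\<bar>..\<bar>a\<bar>})"
      using x by (intro P') (auto simp: R_def)
    ultimately show "((\<lambda>x. P (x + 2 * pi) - P x) has_real_derivative 0) (at x within {-\<bar>a\<bar>..\<bar>a\<bar>})"
      using DERIV_diff by (fastforce simp: per o_def)
  qed simp
  then obtain c where "\<forall>x\<in>{-\<bar>a\<bar>..\<bar>a\<bar>}. P (x + 2 * pi) - P x = c" ..
  moreover have "a \<in> {-\<bar>a\<bar>..\<bar>a\<bar>}" "0 \<in> {-\<bar>a\<bar>..\<bar>a\<bar>}" by auto
  ultimately have "P (a + 2 * pi) - P a = c" "P (0 + 2 * pi) - P 0 = c" by blast+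
  then show ?thesis using int[of a] int[of 0] by simp
qed

text \<open>The sine has constant sign on each half period, where a product formula supplies the
  antiderivative \<open>F\<close>. At m = 0 the value is 4, the integral of |sin|.\<close>

lemma integral_abs_sin_emode:
  "integral {0..2*pi} (\<lambda>t. \<bar>sin t\<bar> * emode m t) = - 4 / (4 * (real m)\<^sup>2 - 1)"
proof -
  define F where "F t = - cos ((2 * real m + 1) * t) / (2 * (2 * real m + 1))
      + cos ((2 * real m - 1) * t) / (2 * (2 * real m - 1))" for t
  have nz: "2 * real m + 1 \<noteq> 0" "2 * real m - 1 \<noteq> 0"
  proof -
    show "2 * real m - 1 \<noteq> 0"
    proof
      assume "2 * real m - 1 = 0"
      then have "real (2 * m) = real 1" by simp
      then show False by (metis of_nat_eq_iff odd_one dvd_triv_left)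
    qed
  qed simp
  have eq: "(sin ((2 * real m + 1) * t)) / 2 - sin ((2 * real m - 1) * t) / 2 = sin t * emode m t" for t
  proof -
    have "(2 * real m + 1) * t = 2 * real m * t + t" "(2 * real m - 1) * t = 2 * real m * t - t"
      by (simp_all add: algebra_simps)
    then show ?thesis unfolding emode_def by (simp only: sin_add sin_diff) (simp add: field_simps)
  qed
  have F: "(F has_real_derivative sin t * emode m t) (at t within S)" for t S
  proof -
    have d: "((\<lambda>t. cos (a * t) / (2 * a)) has_real_derivative - sin (a * t) / 2) (at t within S)"
      if "a \<noteq> 0" for a
      using that by (auto intro!: derivative_eq_intros)
    show ?thesis
      using DERIV_add[OF DERIV_minus[OF d[OF nz(1)]] d[OF nz(2)]] unfolding eq[symmetric]
      by (simp add: F_def[abs_def])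
  qed
  have c: "cos ((2 * real m + 1) * pi) = -1" "cos ((2 * real m - 1) * pi) = -1"
    "cos ((2 * real m + 1) * (2 * pi)) = 1" "cos ((2 * real m - 1) * (2 * pi)) = 1"
  proof -
    have 1: "cos (real (2 * m) * pi) = 1" "sin (real (2 * m) * pi) = 0"
      using cos_npi[of "2 * m"] sin_npi[of "2 * m"] by simp_all
    have 2: "cos (real (4 * m) * pi) = 1" "sin (real (4 * m) * pi) = 0"
      using cos_npi[of "4 * m"] sin_npi[of "4 * m"] by simp_all
    have "(2 * real m + 1) * pi = real (2 * m) * pi + pi" "(2 * real m - 1) * pi = real (2 * m) * pi - pi"
      "(2 * real m + 1) * (2 * pi) = real (4 * m) * pi + 2 * pi"
      "(2 * real m - 1) * (2 * pi) = real (4 * m) * pi - 2 * pi" by (simp_all add: algebra_simps)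
    then show "cos ((2 * real m + 1) * pi) = -1" "cos ((2 * real m - 1) * pi) = -1"
      "cos ((2 * real m + 1) * (2 * pi)) = 1" "cos ((2 * real m - 1) * (2 * pi)) = 1"
      using 1 2
      by (simp_all only: cos_add cos_diff cos_pi sin_pi cos_two_pi sin_two_pi mult_1 mult_zero_left
          diff_zero add_0_right mult_1_right)
  qed
  have "((\<lambda>t. \<bar>sin t\<bar> * emode m t) has_integral (F pi - F 0)) {0..pi}"
  proof (rule has_integral_eq)
    show "((\<lambda>t. sin t * emode m t) has_integral (F pi - F 0)) {0..pi}"
      using F by (intro fundamental_theorem_of_calculus)
        (auto simp: has_real_derivative_iff_has_vector_derivative)
  qed (auto simp: sin_ge_zero)
  moreover have "((\<lambda>t. \<bar>sin t\<bar> * emode m t) has_integral (- F (2*pi) - (- F pi))) {pi..2*pi}"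
  proof (rule has_integral_eq)
    show "((\<lambda>t. - (sin t * emode m t)) has_integral (- F (2*pi) - (- F pi))) {pi..2*pi}"
      using DERIV_minus[OF F] by (intro fundamental_theorem_of_calculus)
        (auto simp: has_real_derivative_iff_has_vector_derivative)
    show "- (sin t * emode m t) = \<bar>sin t\<bar> * emode m t" if "t \<in> {pi..2*pi}" for t
      using sin_le_zero[of t] that by (cases "t = 2 * pi") auto
  qed
  ultimately have "((\<lambda>t. \<bar>sin t\<bar> * emode m t) has_integral ((F pi - F 0) + (- F (2*pi) - (- F pi)))) {0..2*pi}"
    by (intro has_integral_combine[of 0 pi]) auto
  then have "integral {0..2*pi} (\<lambda>t. \<bar>sin t\<bar> * emode m t) = 2 * F pi - F 0 - F (2 * pi)"
    by (simp add: integral_unique)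
  also have "\<dots> = 2 / (2 * real m + 1) - 2 / (2 * real m - 1)"
  proof -
    define x y where "x = 2 * real m + 1" and "y = 2 * real m - 1"
    have "x \<noteq> 0" "y \<noteq> 0" using nz by (simp_all add: x_def y_def)
    moreover have "F pi = 1 / (2 * x) - 1 / (2 * y)" "F 0 = 1 / (2 * y) - 1 / (2 * x)"
      "F (2 * pi) = 1 / (2 * y) - 1 / (2 * x)"
      unfolding F_def c x_def y_def by simp_all
    moreover have "2 * (1 / (2 * x) - 1 / (2 * y)) - (1 / (2 * y) - 1 / (2 * x)) - (1 / (2 * y) - 1 / (2 * x))
        = 2 / x - 2 / y" if "x \<noteq> 0" "y \<noteq> 0" for x y :: real
      using that by (simp add: field_simps)
    ultimately show ?thesis by (simp only: x_def[symmetric] y_def[symmetric])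
  qed
  also have "\<dots> = - 4 / ((2 * real m + 1) * (2 * real m - 1))"
    unfolding diff_frac_eq[OF nz] by (rule arg_cong2[where f = "(/)"]) auto
  also have "(2 * real m + 1) * (2 * real m - 1) = 4 * (real m)\<^sup>2 - 1"
    by (simp add: power2_eq_square algebra_simps)
  finally show ?thesis .
qed

text \<open>Bessel's identity: an upper bound on the residual becomes a lower bound on a partial sum
  of squared coefficients.\<close>

lemma l2_inner_self_minus_emode_sum:
  assumes g: "continuous_on UNIV g"
  shows "l2_inner (\<lambda>t. g t - emode_sum M g t) (\<lambda>t. g t - emode_sum M g t) =
    l2_inner g g - (\<Sum>m\<le>M. (l2_inner g (emode m))\<^sup>2 / emode_sq m)"
proof -
  have c: "continuous_on UNIV (emode_sum M g)" by (rule continuous_even_modes[OF emode_sum_even_modes])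
  have cd: "continuous_on UNIV (\<lambda>t. g t - emode_sum M g t)" using g c by (rule continuous_on_diff)
  have "l2_inner (\<lambda>t. g t - emode_sum M g t) (\<lambda>t. g t - emode_sum M g t) =
    l2_inner g (\<lambda>t. g t - emode_sum M g t) - l2_inner (emode_sum M g) (\<lambda>t. g t - emode_sum M g t)"
    by (rule l2_inner_diff_left[OF g c cd])
  also have "l2_inner (emode_sum M g) (\<lambda>t. g t - emode_sum M g t) = 0"
    by (subst l2_inner_commute) (rule emode_sum_orthogonal[OF g emode_sum_even_modes])
  also have "l2_inner g (\<lambda>t. g t - emode_sum M g t) = l2_inner g g - l2_inner (emode_sum M g) g"
    by (subst l2_inner_commute) (rule l2_inner_diff_left[OF g c g])
  also have "l2_inner (emode_sum M g) g = (\<Sum>m\<le>M. emode_coeff g m * l2_inner (emode m) g)"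
    unfolding emode_sum_def[abs_def]
    by (subst l2_inner_sum_left) (auto intro!: continuous_intros g simp: l2_inner_scale_left)
  also have "\<dots> = (\<Sum>m\<le>M. (l2_inner g (emode m))\<^sup>2 / emode_sq m)"
    by (simp add: emode_coeff_def l2_inner_commute[of "emode _"] power2_eq_square)
  finally show ?thesis by simp
qed

text \<open>One sixteenth of the squared inner product of |sin| with \<open>emode m\<close>.\<close>

definition tail_summand :: "nat \<Rightarrow> real" where
  "tail_summand m = 1 / (4 * (real m)\<^sup>2 - 1)\<^sup>2"

lemma tail_summand_Suc:
  "tail_summand (Suc m) = 1 / ((2 * real m + 1)\<^sup>2 * (2 * real m + 3)\<^sup>2)"
proof -
  have "4 * (real (Suc m))\<^sup>2 - 1 = (2 * real m + 1) * (2 * real m + 3)"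
    by (simp add: power2_eq_square algebra_simps)
  then show ?thesis unfolding tail_summand_def by (simp add: power_mult_distrib)
qed

text \<open>Partial fractions: with a = 2 * m + 1, four times the summand is 1/a^2 + 1/(a + 2)^2 -
  1/a + 1/(a + 2). The squares give twice the inverse odd squares up to boundary terms, and the rest
  telescopes. The odd squares are written as all squares minus the even ones, which are a quarter of
  a shorter full sum.\<close>

lemma sum_tail_summand_closed:
  "4 * (\<Sum>m<M. tail_summand (Suc m)) =
    2 * ((\<Sum>n<2*M. 1 / (real n + 1)\<^sup>2) - (\<Sum>n<M. 1 / (real n + 1)\<^sup>2) / 4) - 2
    + 1 / (2 * real M + 1)\<^sup>2 + 1 / (2 * real M + 1)"
proof (induction M)
  case (Suc M)
  define a where "a = 2 * real M + 1"
  have a: "a > 0" by (simp add: a_def)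
  have step: "4 * (1 / (a\<^sup>2 * (a + 2)\<^sup>2)) + 1 / a\<^sup>2 + 1 / a = 2 * (1 / a\<^sup>2) + 1 / (a + 2)\<^sup>2 + 1 / (a + 2)"
    using a by (simp add: divide_simps) (simp add: power2_eq_square algebra_simps)
  have e1: "(\<Sum>n<2 * Suc M. 1 / (real n + 1)\<^sup>2) =
      (\<Sum>n<2*M. 1 / (real n + 1)\<^sup>2) + 1 / a\<^sup>2 + 1 / (a + 1)\<^sup>2"
    by (simp add: a_def add.commute)
  \<comment> \<open>Here a + 1 = 2 * (M + 1): the even term, which cancels against the new term of
    the subtracted sum.\<close>
  have e2: "1 / (a + 1)\<^sup>2 = 1 / (real M + 1)\<^sup>2 / 4"
  proof -
    have "(a + 1)\<^sup>2 = 4 * (real M + 1)\<^sup>2" by (simp add: a_def power2_eq_square algebra_simps)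
    then show ?thesis by simp
  qed
  have e3: "2 * real (Suc M) + 1 = a + 2" "2 * real M + 1 = a" "2 * real M + 3 = a + 2"
    by (simp_all add: a_def)
  have lin: "4 * (T + u) = 2 * ((Q2 + p + w / 4) - (Q1 + w) / 4) - 2 + q + s"
    if "4 * T = 2 * (Q2 - Q1 / 4) - 2 + p + r" "4 * u + p + r = 2 * p + q + s"
    for T u Q1 Q2 p q r s w :: real
    using that by argo
  show ?case
    unfolding e1 e2 e3 sum.lessThan_Suc[of _ M] tail_summand_Suc[of M]
    using lin[OF Suc.IH[unfolded e3] step] .
qed simp

text \<open>\<open>U\<close> adds to the partial sum the claimed bound for the missing tail. It
  decreases to the value of the full series and so never falls below it. The factor 1/6 makes the
  drop of the added term over one step asymptotic to the summand.\<close>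

lemma sum_tail_summand_lower:
  "(\<Sum>m<M. tail_summand (Suc m)) \<ge> (pi\<^sup>2 - 8) / 16 - 1 / (6 * (2 * real M + 1) ^ 3)"
proof -
  define U where "U M = (\<Sum>m<M. tail_summand (Suc m)) + 1 / (6 * (2 * real M + 1) ^ 3)" for M
  have "decseq U"
  proof (rule decseq_SucI)
    fix M
    define x where "x = 2 * real M + 2"
    have x: "x > 1" by (simp add: x_def)
    have "1 / ((x - 1)\<^sup>2 * (x + 1)\<^sup>2) + 1 / (6 * (x + 1) ^ 3) \<le> 1 / (6 * (x - 1) ^ 3)"
    proof -
      \<comment> \<open>In the midpoint variable \<open>x\<close> the numerator collapses to the
        constant 8, whose sign settles the inequality.\<close>
      have "1 / (6 * (x - 1) ^ 3) - 1 / (6 * (x + 1) ^ 3) - 1 / ((x - 1)\<^sup>2 * (x + 1)\<^sup>2)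
          = ((x + 1) ^ 3 - (x - 1) ^ 3 - 6 * (x - 1) * (x + 1)) / (6 * (x - 1) ^ 3 * (x + 1) ^ 3)"
        using x by (simp add: divide_simps power2_eq_square power3_eq_cube) (simp add: algebra_simps)
      moreover have "(x + 1) ^ 3 - (x - 1) ^ 3 - 6 * (x - 1) * (x + 1) = 8"
        by (simp add: power3_eq_cube algebra_simps)
      moreover have "8 / (6 * (x - 1) ^ 3 * (x + 1) ^ 3) \<ge> 0" using x by simp
      ultimately have "0 \<le> 1 / (6 * (x - 1) ^ 3) - 1 / (6 * (x + 1) ^ 3) - 1 / ((x - 1)\<^sup>2 * (x + 1)\<^sup>2)"
        by simp
      moreover have "c + b \<le> a" if "0 \<le> a - b - c" for a b c :: real using that by linarith
      ultimately show ?thesis by blast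
    qed
    moreover have e: "2 * real M + 1 = x - 1" "2 * real M + 3 = x + 1" "2 * real (Suc M) + 1 = x + 1"
      by (simp_all add: x_def)
    ultimately show "U (Suc M) \<le> U M" unfolding U_def sum.lessThan_Suc tail_summand_Suc e by simp
  qed
  moreover have "U \<longlonglongrightarrow> (pi\<^sup>2 - 8) / 16"
  proof -
    define Q where "Q M = (\<Sum>n<M. 1 / (real n + 1)\<^sup>2)" for M
    have Q: "Q \<longlonglongrightarrow> pi\<^sup>2 / 6"
      using inverse_squares_sums unfolding sums_def Q_def by (simp add: add.commute)
    then have "(Q \<circ> (\<lambda>M. 2 * M)) \<longlonglongrightarrow> pi\<^sup>2 / 6"
      by (rule LIMSEQ_subseq_LIMSEQ) (simp add: strict_mono_def)
    then have Q2: "(\<lambda>M. Q (2 * M)) \<longlonglongrightarrow> pi\<^sup>2 / 6" by (simp add: o_def)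
    have z: "(\<lambda>M. 1 / (2 * real M + 1)\<^sup>2) \<longlonglongrightarrow> 0" "(\<lambda>M. 1 / (2 * real M + 1)) \<longlonglongrightarrow> 0"
      "(\<lambda>M. 1 / (6 * (2 * real M + 1) ^ 3)) \<longlonglongrightarrow> 0" by real_asymp+
    have U: "U = (\<lambda>M. (2 * (Q (2 * M) - Q M / 4) - 2 + 1 / (2 * real M + 1)\<^sup>2 + 1 / (2 * real M + 1)) / 4
        + 1 / (6 * (2 * real M + 1) ^ 3))"
    proof
      fix M
      have "(\<Sum>m<M. tail_summand (Suc m)) =
        (2 * (Q (2 * M) - Q M / 4) - 2 + 1 / (2 * real M + 1)\<^sup>2 + 1 / (2 * real M + 1)) / 4"
        unfolding Q_def sum_tail_summand_closed[symmetric] by simp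
      then show "U M = (2 * (Q (2 * M) - Q M / 4) - 2 + 1 / (2 * real M + 1)\<^sup>2 + 1 / (2 * real M + 1)) / 4
        + 1 / (6 * (2 * real M + 1) ^ 3)" by (simp only: U_def)
    qed
    have "U \<longlonglongrightarrow> (2 * (pi\<^sup>2 / 6 - pi\<^sup>2 / 6 / 4) - 2 + 0 + 0) / 4 + 0"
      unfolding U by (intro tendsto_intros Q Q2 z) auto
    then show ?thesis by (simp add: field_simps)
  qed
  ultimately have "(pi\<^sup>2 - 8) / 16 \<le> U M" by (rule decseq_ge)
  then show ?thesis unfolding U_def by linarith
qed

section \<open>The truncation error of |sin| and its shifts\<close>

definition sin_remainder :: "nat \<Rightarrow> real \<Rightarrow> real" where
  "sin_remainder M t = \<bar>sin t\<bar> - emode_sum M (\<lambda>t. \<bar>sin t\<bar>) t"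

lemma continuous_sin_remainder: "continuous_on UNIV (sin_remainder M)"
  unfolding sin_remainder_def[abs_def]
  by (intro continuous_intros continuous_even_modes[OF emode_sum_even_modes])

lemma emode_periodic: "emode m (t + 2 * pi) = emode m t"
proof -
  have "2 * real m * (t + 2 * pi) = 2 * real m * t + of_int (2 * int m) * (2 * pi)"
    by (simp add: algebra_simps)
  then show ?thesis unfolding emode_def using cos.plus_of_int[of "2 * real m * t" "2 * int m"] by simp
qed

lemma sin_remainder_periodic: "sin_remainder M (t + 2 * pi) = sin_remainder M t"
  by (simp add: sin_remainder_def emode_sum_def emode_periodic)

text \<open>The squared norm pi of |sin| equals 8 / pi from the mean plus 16 / pi times the full
  series (pi^2 - 8) / 16. These cancel, and only the tail estimate survives.\<close>

lemma l2_inner_sin_remainder: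
  assumes "M \<ge> 1"
  shows "l2_inner (sin_remainder M) (sin_remainder M) \<le> 1 / real M ^ 3"
proof -
  let ?s = "\<lambda>t::real. \<bar>sin t\<bar>"
  have s: "continuous_on UNIV ?s" by (intro continuous_intros)
  have inner: "l2_inner ?s (emode m) = - 4 / (4 * (real m)\<^sup>2 - 1)" for m
    using integral_abs_sin_emode[of m] by (simp add: l2_inner_eq_integral s continuous_emode)
  have "l2_inner ?s ?s = pi"
  proof -
    have "\<bar>sin t\<bar> * \<bar>sin t\<bar> = 1 / 2 - (1 / 2) * cos (of_int 2 * t)" for t :: real
      using cos_double_sin[of t] by (simp add: abs_mult[symmetric] power2_eq_square field_simps)
    then have "l2_inner ?s ?s = integral {0..2*pi} (\<lambda>t. 1 / 2 - (1 / 2) * cos (of_int 2 * t))"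
      by (simp add: l2_inner_eq_integral s)
    also have "\<dots> = integral {0..2*pi} (\<lambda>t::real. 1 / 2) - (1 / 2) * integral {0..2*pi} (\<lambda>t. cos (of_int 2 * t))"
      unfolding integral_mult_right[symmetric]
      by (intro integral_diff integrable_on_cont continuous_intros)
    also have "\<dots> = pi" unfolding integral_cos_int by simp
    finally show ?thesis .
  qed
  moreover have "(\<Sum>m\<le>M. (l2_inner ?s (emode m))\<^sup>2 / emode_sq m) = 8 / pi + 16 / pi * (\<Sum>m<M. tail_summand (Suc m))"
  proof -
    have "(\<Sum>m\<le>M. (l2_inner ?s (emode m))\<^sup>2 / emode_sq m) =
        (l2_inner ?s (emode 0))\<^sup>2 / emode_sq 0 + (\<Sum>m<M. (l2_inner ?s (emode (Suc m)))\<^sup>2 / emode_sq (Suc m))"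
      by (simp add: lessThan_Suc_atMost[symmetric] sum.lessThan_Suc_shift del: sum.lessThan_Suc)
    also have "(l2_inner ?s (emode 0))\<^sup>2 / emode_sq 0 = 8 / pi"
      by (simp add: inner emode_sq_def)
    also have "(\<Sum>m<M. (l2_inner ?s (emode (Suc m)))\<^sup>2 / emode_sq (Suc m)) = (\<Sum>m<M. 16 / pi * tail_summand (Suc m))"
      by (intro sum.cong refl) (simp add: inner emode_sq_def tail_summand_def power_divide del: of_nat_Suc)
    finally show ?thesis by (simp add: sum_distrib_left)
  qed
  ultimately have "l2_inner (sin_remainder M) (sin_remainder M) = pi - 8 / pi - 16 / pi * (\<Sum>m<M. tail_summand (Suc m))"
    using l2_inner_self_minus_emode_sum[OF s, of M] by (simp add: sin_remainder_def[abs_def])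
  also have "\<dots> \<le> pi - 8 / pi - 16 / pi * ((pi\<^sup>2 - 8) / 16 - 1 / (6 * (2 * real M + 1) ^ 3))"
    using sum_tail_summand_lower[of M] by (intro diff_left_mono mult_left_mono) auto
  also have "\<dots> = (16 / (6 * pi)) * (1 / (2 * real M + 1) ^ 3)"
    by (simp add: field_simps power2_eq_square)
  \<comment> \<open>16 / (6 * pi) is below 1, and 2 * M + 1 exceeds M.\<close>
  also have "\<dots> \<le> 1 * (1 / real M ^ 3)"
    using assms pi_gt3 by (intro mult_mono divide_left_mono power_mono) auto
  finally show ?thesis by simp
qed

lemma l2_inner_sin_remainder_shift:
  assumes "M \<ge> 1"
  shows "l2_inner (\<lambda>t. sin_remainder M (t + a)) (\<lambda>t. sin_remainder M (t + a)) \<le> 1 / real M ^ 3"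
proof -
  have c: "continuous_on UNIV (\<lambda>t. sin_remainder M (t + a))"
    by (rule continuous_on_compose2[OF continuous_sin_remainder]) (auto intro!: continuous_intros)
  have "l2_inner (\<lambda>t. sin_remainder M (t + a)) (\<lambda>t. sin_remainder M (t + a)) =
      integral {0..2*pi} (\<lambda>t. (\<lambda>t. sin_remainder M t * sin_remainder M t) (t + a))"
    by (simp add: l2_inner_eq_integral c)
  also have "\<dots> = integral {0..2*pi} (\<lambda>t. sin_remainder M t * sin_remainder M t)"
    by (intro integral_periodic_shift continuous_intros continuous_sin_remainder)
       (simp add: sin_remainder_periodic)
  also have "\<dots> = l2_inner (sin_remainder M) (sin_remainder M)"
    by (simp add: l2_inner_eq_integral continuous_sin_remainder)
  finally show ?thesis using l2_inner_sin_remainder[OF assms] by simp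
qed

lemma integral_abs_sin_shift: "integral {0..2*pi} (\<lambda>t. \<bar>sin (t + a)\<bar>) = 4"
proof -
  have "integral {0..2*pi} (\<lambda>t. \<bar>sin (t + a)\<bar>) = integral {0..2*pi} (\<lambda>t. \<bar>sin t\<bar>)"
    by (rule integral_periodic_shift) (auto intro!: continuous_intros)
  then show ?thesis using integral_abs_sin_emode[of 0] by (simp add: emode_def)
qed

section \<open>The excluded area in polar form\<close>


definition polar_vec :: "real \<Rightarrow> real \<Rightarrow> real^2" where
  "polar_vec r p = vector [r * cos p, r * sin p]"

definition polar_list :: "nat \<Rightarrow> (nat \<Rightarrow> real) \<Rightarrow> (nat \<Rightarrow> real) \<Rightarrow> (real^2) list" where
  "polar_list N r p = map (\<lambda>i. polar_vec (r i) (p i)) [0..<N]"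

lemma length_polar_list [simp]: "length (polar_list N r p) = N"
  by (simp add: polar_list_def)

lemma polar_vec_exists: "\<exists>p. v = polar_vec (norm v) p"
proof (cases "v = 0")
  case True
  then show ?thesis by (simp add: polar_vec_def vec_eq_iff forall_2)
next
  case False
  have "(v $ 1 / norm v)\<^sup>2 + (v $ 2 / norm v)\<^sup>2 = ((v$1)\<^sup>2 + (v$2)\<^sup>2) / (norm v)\<^sup>2"
    by (simp add: power_divide add_divide_distrib)
  also have "\<dots> = 1" using False by (simp add: norm_vec2 vec_eq_iff forall_2 sum_power2_eq_zero_iff)
  finally obtain p where p: "v $ 1 / norm v = cos p" "v $ 2 / norm v = sin p"
    using sincos_total_2pi by metis
  have "v = polar_vec (norm v) p" using False
    by (simp add: polar_vec_def vec_eq_iff forall_2 p[symmetric])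
  then show ?thesis ..
qed

lemma polar_list_exists: "\<exists>N r p. (\<forall>i. r i \<ge> 0) \<and> V = polar_list N r p"
proof -
  obtain P where P: "\<And>v. polar_vec (norm v) (P v) = v" using polar_vec_exists by metis
  have "V = polar_list (length V) (\<lambda>i. norm (V ! i)) (\<lambda>i. P (V ! i))"
    unfolding polar_list_def P by (simp add: map_nth)
  then show ?thesis by (intro exI conjI) auto
qed

definition polar_ex :: "nat \<Rightarrow> (nat \<Rightarrow> real) \<Rightarrow> (nat \<Rightarrow> real) \<Rightarrow> real \<Rightarrow> real" where
  "polar_ex N r p t =
     (\<Sum>i<N. \<Sum>j<N. r i * r j * (\<bar>sin (p j - p i)\<bar> + \<bar>sin (t + (p j - p i))\<bar>))"

lemma excluded_area_polar_list:
  assumes r: "\<And>i. r i \<ge> 0"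
  shows "excluded_area t (zonotope (polar_list N r p)) = polar_ex N r p t"
proof -
  have det: "\<bar>det2 (polar_vec a x) (polar_vec b y)\<bar> = a * b * \<bar>sin (y - x)\<bar>" if "a \<ge> 0" "b \<ge> 0" for a b x y
  proof -
    have "det2 (polar_vec a x) (polar_vec b y) = (a * b) * sin (y - x)"
      by (simp add: det2_def polar_vec_def sin_diff algebra_simps)
    then show ?thesis using that by (simp add: abs_mult)
  qed
  have rot: "map (rot t) (polar_list N r p) = polar_list N r (\<lambda>i. t + p i)"
    by (simp add: polar_list_def polar_vec_def vec_eq_iff forall_2 cos_add sin_add algebra_simps)
  have "pair_area (polar_list N r p) (polar_list N r q) = (\<Sum>i<N. \<Sum>j<N. r i * r j * \<bar>sin (q j - p i)\<bar>)" for q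
    unfolding pair_area_def polar_list_def
    by (simp add: o_def interv_sum_list_conv_sum_set_nat det r lessThan_atLeast0)
  then show ?thesis unfolding excluded_area_zonotope rot polar_ex_def
    by (simp add: sum.distrib distrib_left add_diff_eq)
qed

lemma excluded_area_zonotope_polar:
  "\<exists>N r p. (\<forall>i. r i \<ge> 0) \<and> (\<forall>t. excluded_area t (zonotope V) = polar_ex N r p t)"
  using polar_list_exists[of V] excluded_area_polar_list by blast

lemma continuous_polar_ex: "continuous_on UNIV (polar_ex N r p)"
  unfolding polar_ex_def[abs_def] by (intro continuous_intros)

text \<open>The terms without \<open>t\<close> are nonnegative and are dropped; every shifted |sin|
  integrates to 4. A bound on the mean thus becomes a bound on the total length.\<close>

lemma integral_polar_ex_ge:
  assumes r: "\<And>i. r i \<ge> 0"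
  shows "4 * (\<Sum>i<N. r i)\<^sup>2 \<le> integral {0..2*pi} (polar_ex N r p)"
proof -
  have "4 * (\<Sum>i<N. r i)\<^sup>2 = (\<Sum>i<N. \<Sum>j<N. r i * r j * 4)"
    by (simp add: power2_eq_square sum_product sum_distrib_left mult.commute)
  also have "\<dots> = (\<Sum>i<N. \<Sum>j<N. integral {0..2*pi} (\<lambda>t. r i * r j * \<bar>sin (t + (p j - p i))\<bar>))"
    by (simp add: integral_abs_sin_shift)
  also have "\<dots> = integral {0..2*pi} (\<lambda>t. \<Sum>i<N. \<Sum>j<N. r i * r j * \<bar>sin (t + (p j - p i))\<bar>)"
    by (subst integral_sum; (intro finite_lessThan integrable_on_cont continuous_intros)?)
       (intro sum.cong refl integral_sum[symmetric] finite_lessThan integrable_on_cont continuous_intros)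
  also have "\<dots> \<le> integral {0..2*pi} (polar_ex N r p)"
  proof (intro integral_le integrable_on_cont continuous_polar_ex)
    show "(\<Sum>i<N. \<Sum>j<N. r i * r j * \<bar>sin (t + (p j - p i))\<bar>) \<le> polar_ex N r p t" for t
      unfolding polar_ex_def using r by (intro sum_mono mult_left_mono) auto
  qed (intro continuous_intros)
  finally show ?thesis .
qed

text \<open>Cauchy-Schwarz with each weight split into two square roots. Only the total weight
  enters, not the number of terms.\<close>

lemma l2_inner_weighted_sum:
  assumes P: "finite P" "\<And>k. k \<in> P \<Longrightarrow> w k \<ge> 0" "\<And>k. k \<in> P \<Longrightarrow> continuous_on UNIV (g k)"
    and B: "\<And>k. k \<in> P \<Longrightarrow> l2_inner (g k) (g k) \<le> B"
  shows "l2_inner (\<lambda>t. \<Sum>k\<in>P. w k * g k t) (\<lambda>t. \<Sum>k\<in>P. w k * g k t) \<le> (sum w P)\<^sup>2 * B"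
proof -
  have "l2_inner (\<lambda>t. \<Sum>k\<in>P. w k * g k t) (\<lambda>t. \<Sum>k\<in>P. w k * g k t)
      \<le> integral {0..2*pi} (\<lambda>t. sum w P * (\<Sum>k\<in>P. w k * (g k t * g k t)))"
  proof (rule l2_inner_self_mono)
    fix t
    have "(\<Sum>k\<in>P. sqrt (w k) * (sqrt (w k) * g k t))\<^sup>2 \<le>
        (\<Sum>k\<in>P. (sqrt (w k))\<^sup>2) * (\<Sum>k\<in>P. (sqrt (w k) * g k t)\<^sup>2)"
      by (rule Cauchy_Schwarz_ineq_sum)
    also have "(\<Sum>k\<in>P. sqrt (w k) * (sqrt (w k) * g k t)) = (\<Sum>k\<in>P. w k * g k t)"
      using P(2) by (intro sum.cong) (auto simp: mult.assoc[symmetric])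
    also have "(\<Sum>k\<in>P. (sqrt (w k))\<^sup>2) = sum w P" using P(2) by (intro sum.cong) auto
    also have "(\<Sum>k\<in>P. (sqrt (w k) * g k t)\<^sup>2) = (\<Sum>k\<in>P. w k * (g k t * g k t))"
      using P(2) by (intro sum.cong) (auto simp: power_mult_distrib power2_eq_square)
    finally show "(\<Sum>k\<in>P. w k * g k t)\<^sup>2 \<le> sum w P * (\<Sum>k\<in>P. w k * (g k t * g k t))" .
  qed (use P in \<open>auto intro!: continuous_intros\<close>)
  also have "\<dots> = sum w P * (\<Sum>k\<in>P. w k * l2_inner (g k) (g k))"
    using P by (simp add: integral_sum integrable_on_cont continuous_on_mult continuous_on_const
        l2_inner_eq_integral)
  also have "\<dots> \<le> sum w P * (\<Sum>k\<in>P. w k * B)"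
    using P B by (intro mult_left_mono sum_mono sum_nonneg) auto
  also have "\<dots> = (sum w P)\<^sup>2 * B" by (simp add: power2_eq_square sum_distrib_right[symmetric])
  finally show ?thesis .
qed

lemma even_modes_add:
  assumes "p \<in> even_modes M" "q \<in> even_modes M"
  shows "(\<lambda>t. p t + q t) \<in> even_modes M"
  using even_modes_diff[OF assms(1) even_modes_diff[OF const_in_even_modes[of 0] assms(2)]] by simp

text \<open>Truncating the Fourier series of each \<open>\<bar>sin (t + (p j - p i))\<bar>\<close> produces sine terms as well,
  but they cancel between \<open>(i, j)\<close> and \<open>(j, i)\<close>.\<close>

lemma polar_ex_even_modes_approx:
  assumes r: "\<And>i. r i \<ge> 0" and M: "M \<ge> 1"
  obtains h where "h \<in> even_modes M"
    "l2_inner (\<lambda>t. polar_ex N r p t - h t) (\<lambda>t. polar_ex N r p t - h t) \<le> (\<Sum>i<N. r i) ^ 4 / real M ^ 3"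
proof -
  define P where "P = {..<N} \<times> {..<N}"
  define w where "w k = r (fst k) * r (snd k)" for k
  define a where "a k = p (snd k) - p (fst k)" for k
  have P: "finite P" by (simp add: P_def)
  have w: "w k \<ge> 0" for k using r by (simp add: w_def)
  have pex: "polar_ex N r p t = (\<Sum>k\<in>P. w k * \<bar>sin (a k)\<bar>) + (\<Sum>k\<in>P. w k * \<bar>sin (t + a k)\<bar>)" for t
    unfolding polar_ex_def P_def w_def a_def
    by (simp add: sum.cartesian_product case_prod_unfold sum.distrib distrib_left)
  have W: "sum w P = (\<Sum>i<N. r i)\<^sup>2"
    unfolding P_def w_def by (simp add: power2_eq_square sum_product sum.cartesian_product case_prod_unfold)
  let ?S = "emode_sum M (\<lambda>t. \<bar>sin t\<bar>)"
  \<comment> \<open>The part without \<open>t\<close> is constant and is kept; each shifted |sin| is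
    replaced by its truncated series.\<close>
  define h where "h t = (\<Sum>k\<in>P. w k * \<bar>sin (a k)\<bar>) + (\<Sum>k\<in>P. w k * ?S (t + a k))" for t
  have sin0: "(\<Sum>k\<in>P. w k * sin (2 * real m * a k)) = 0" for m
  proof -
    have "(\<Sum>k\<in>P. w k * sin (2 * real m * a k)) =
        (\<Sum>i<N. \<Sum>j<N. r i * r j * sin (2 * real m * (p j - p i)))"
      unfolding P_def w_def a_def by (simp add: sum.cartesian_product case_prod_unfold)
    also have "\<dots> = (\<Sum>j<N. \<Sum>i<N. r i * r j * sin (2 * real m * (p j - p i)))" by (rule sum.swap)
    also have "\<dots> = (\<Sum>j<N. \<Sum>i<N. - (r j * r i * sin (2 * real m * (p i - p j))))"
    proof (intro sum.cong refl)
      fix i j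
      have "2 * real m * (p j - p i) = - (2 * real m * (p i - p j))" by (simp add: algebra_simps)
      then show "r i * r j * sin (2 * real m * (p j - p i)) = - (r j * r i * sin (2 * real m * (p i - p j)))"
        by (simp only: sin_minus) simp
    qed
    also have "\<dots> = - (\<Sum>k\<in>P. w k * sin (2 * real m * a k))"
      unfolding P_def w_def a_def by (simp add: sum.cartesian_product case_prod_unfold sum_negf)
    finally show ?thesis by simp
  qed
  have "(\<Sum>k\<in>P. w k * ?S (t + a k)) =
      (\<Sum>m\<le>M. (emode_coeff (\<lambda>t. \<bar>sin t\<bar>) m * (\<Sum>k\<in>P. w k * cos (2 * real m * a k))) * emode m t)" for t
  proof -
    \<comment> \<open>The addition formula splits off a sine of \<open>t\<close>, which lies outside
      the span; \<open>sin0\<close> removes it after summation.\<close>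
    have em: "emode m (t + x) = cos (2 * real m * x) * emode m t - sin (2 * real m * x) * sin (2 * real m * t)" for m x
      unfolding emode_def distrib_left cos_add by (simp add: mult.commute)
    have "(\<Sum>k\<in>P. w k * ?S (t + a k)) =
        (\<Sum>m\<le>M. \<Sum>k\<in>P. emode_coeff (\<lambda>t. \<bar>sin t\<bar>) m * (w k * emode m (t + a k)))"
      unfolding emode_sum_def sum_distrib_left by (subst sum.swap) (simp add: mult.left_commute)
    also have "\<dots> = (\<Sum>m\<le>M. emode_coeff (\<lambda>t. \<bar>sin t\<bar>) m * ((\<Sum>k\<in>P. w k * cos (2 * real m * a k)) * emode m t
        - (\<Sum>k\<in>P. w k * sin (2 * real m * a k)) * sin (2 * real m * t)))"
      unfolding em sum_distrib_left[symmetric] sum_distrib_right sum_subtractf[symmetric]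
      by (simp add: right_diff_distrib mult.assoc)
    finally show ?thesis unfolding sin0 by (simp add: mult.assoc)
  qed
  then have "(\<lambda>t. \<Sum>k\<in>P. w k * ?S (t + a k)) \<in> even_modes M"
    unfolding even_modes_iff by (intro exI ext)
  then have hM: "h \<in> even_modes M"
    unfolding h_def[abs_def] by (intro even_modes_add const_in_even_modes)
  have diff: "(\<lambda>t. polar_ex N r p t - h t) = (\<lambda>t. \<Sum>k\<in>P. w k * sin_remainder M (t + a k))"
    by (simp add: pex h_def sin_remainder_def right_diff_distrib sum_subtractf)
  \<comment> \<open>The weights \<open>r i * r j\<close> have total (sum of r)^2, which the weighted
    estimate squares again: hence the fourth power.\<close>
  have "l2_inner (\<lambda>t. \<Sum>k\<in>P. w k * sin_remainder M (t + a k)) (\<lambda>t. \<Sum>k\<in>P. w k * sin_remainder M (t + a k))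
      \<le> (sum w P)\<^sup>2 * (1 / real M ^ 3)"
    using P w l2_inner_sin_remainder_shift[OF M]
    by (intro l2_inner_weighted_sum continuous_on_compose2[OF continuous_sin_remainder])
       (auto intro!: continuous_intros)
  then have "l2_inner (\<lambda>t. polar_ex N r p t - h t) (\<lambda>t. polar_ex N r p t - h t) \<le> (\<Sum>i<N. r i) ^ 4 / real M ^ 3"
    unfolding diff W by (simp add: power_mult[symmetric])
  with hM show thesis by (rule that)
qed

section \<open>Rounding the directions\<close>

lemma abs_sin_add_int_pi: "\<bar>sin (x + of_int n * pi)\<bar> = \<bar>sin x\<bar>"
proof -
  have "sin (of_int n * pi) = 0" using sin_zero_iff_int2 by blast
  moreover have "\<bar>cos (of_int n * pi)\<bar> = 1"
    using sin_cos_squared_add[of "of_int n * pi"] calculation by (auto simp: power2_eq_1_iff)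
  ultimately show ?thesis by (simp add: sin_add abs_mult)
qed

lemma abs_sin_lipschitz: "\<bar>\<bar>sin x\<bar> - \<bar>sin y\<bar>\<bar> \<le> \<bar>x - y :: real\<bar>"
proof -
  have "\<bar>sin x - sin y\<bar> = 2 * \<bar>sin ((x - y) / 2)\<bar> * \<bar>cos ((x + y) / 2)\<bar>"
    by (simp add: sin_diff_sin abs_mult)
  also have "\<dots> \<le> 2 * \<bar>(x - y) / 2\<bar> * 1"
    by (intro mult_mono abs_sin_x_le_abs_x order_refl abs_cos_le_one) auto
  finally have "\<bar>sin x - sin y\<bar> \<le> \<bar>x - y\<bar>" by simp
  then show ?thesis by (rule order_trans[OF abs_triangle_ineq3])
qed

text \<open>Round every direction down to a multiple of \<open>\<pi> / k\<close>; modulo \<open>\<pi>\<close>, which the formula for the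
  excluded area does not see, only \<open>k\<close> directions remain, and parallel vectors are added up.\<close>

lemma polar_ex_discretise:
  assumes r: "\<And>i. r i \<ge> 0" and k: "k \<ge> 1"
  shows "\<exists>c q. (\<forall>a. c a \<ge> 0) \<and>
    (\<forall>t. \<bar>polar_ex N r p t - polar_ex k c q t\<bar> \<le> 4 * pi / real k * (\<Sum>i<N. r i)\<^sup>2)"
proof -
  \<comment> \<open>\<open>s i\<close> is the rounded direction and \<open>z i\<close> its index;
    \<open>g i\<close> is the residue modulo \<open>k\<close>, so \<open>s i\<close> and
    \<open>q (g i)\<close> differ by a multiple of pi. \<open>c\<close> adds up the lengths that
    share a residue.\<close>
  define z where "z i = \<lfloor>real k * p i / pi\<rfloor>" for i
  define g where "g i = nat (z i mod int k)" for i
  define s where "s i = of_int (z i) * pi / real k" for i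
  define q where "q a = real a * pi / real k" for a
  define c where "c a = (\<Sum>i | i < N \<and> g i = a. r i)" for a
  have g: "g i < k" for i using k by (simp add: g_def nat_less_iff)
  have gint: "int (g i) = z i mod int k" for i using k by (simp add: g_def)
  have sq: "s i = q (g i) + of_int (z i div int k) * pi" for i
  proof -
    have "z i = z i div int k * int k + int (g i)" unfolding gint by (rule div_mult_mod_eq[symmetric])
    then have "real_of_int (z i) = of_int (z i div int k) * real k + real (g i)"
      by (metis of_int_add of_int_mult of_int_of_nat_eq)
    then show ?thesis using k by (simp add: s_def q_def add_divide_distrib distrib_right)
  qed
  have ps: "\<bar>p i - s i\<bar> \<le> pi / real k" for i
  proof -
    have "of_int (z i) \<le> real k * p i / pi" "real k * p i / pi \<le> of_int (z i) + 1"
      unfolding z_def by linarith+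
    then have "s i \<le> p i" "p i \<le> s i + pi / real k" using k by (simp_all add: s_def field_simps)
    then show ?thesis by (simp add: abs_le_iff)
  qed
  have group: "(\<Sum>a<k. c a * G a) = (\<Sum>i<N. r i * G (g i))" for G :: "nat \<Rightarrow> real"
  proof -
    have "(\<Sum>a<k. c a * G a) = (\<Sum>a<k. \<Sum>i | i \<in> {..<N} \<and> g i = a. r i * G (g i))"
      unfolding c_def sum_distrib_right by (intro sum.cong) auto
    also have "\<dots> = (\<Sum>i<N. r i * G (g i))" using g by (intro sum.group) auto
    finally show ?thesis .
  qed
  have pq: "polar_ex k c q t = (\<Sum>i<N. \<Sum>j<N. r i * r j * (\<bar>sin (s j - s i)\<bar> + \<bar>sin (t + (s j - s i))\<bar>))" for t
  proof -
    have sh: "\<bar>sin (x + (s j - s i))\<bar> = \<bar>sin (x + (q (g j) - q (g i)))\<bar>" for x i j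
    proof -
      have "x + (s j - s i) = (x + (q (g j) - q (g i))) + of_int (z j div int k - z i div int k) * pi"
        by (simp add: sq algebra_simps)
      then show ?thesis by (simp only: abs_sin_add_int_pi)
    qed
    define G where "G a b = \<bar>sin (q b - q a)\<bar> + \<bar>sin (t + (q b - q a))\<bar>" for a b
    have "polar_ex k c q t = (\<Sum>a<k. c a * (\<Sum>b<k. c b * G a b))"
      unfolding polar_ex_def G_def by (simp add: sum_distrib_left mult.assoc)
    also have "\<dots> = (\<Sum>i<N. r i * (\<Sum>j<N. r j * G (g i) (g j)))" by (simp add: group)
    also have "\<dots> = (\<Sum>i<N. \<Sum>j<N. r i * r j * G (g i) (g j))" by (simp add: sum_distrib_left mult.assoc)
    finally show ?thesis using sh[of 0] sh[of t] by (simp add: G_def)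
  qed
  show ?thesis
  proof (rule exI[of _ c], rule exI[of _ q], intro conjI allI)
    show "c a \<ge> 0" for a unfolding c_def using r by (intro sum_nonneg) auto
    fix t
    \<comment> \<open>Each direction moves by at most pi / k, a difference of two by at most 2 * pi
      / k, and that difference enters two sines.\<close>
    have lip: "\<bar>(\<bar>sin (p j - p i)\<bar> + \<bar>sin (t + (p j - p i))\<bar>) - (\<bar>sin (s j - s i)\<bar> + \<bar>sin (t + (s j - s i))\<bar>)\<bar>
        \<le> 4 * pi / real k" for i j
    proof -
      have "\<bar>(p j - s j) - (p i - s i)\<bar> \<le> pi / real k + pi / real k"
        by (rule order_trans[OF abs_triangle_ineq4 add_mono[OF ps ps]])
      then have d: "\<bar>\<bar>sin x\<bar> - \<bar>sin y\<bar>\<bar> \<le> pi / real k + pi / real k"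
        if "x - y = (p j - s j) - (p i - s i)" for x y
        using abs_sin_lipschitz[of x y] that by simp
      have "\<bar>(a + b) - (a' + b')\<bar> \<le> \<bar>a - a'\<bar> + \<bar>b - b'\<bar>" for a b a' b' :: real by linarith
      then show ?thesis
        by (rule order_trans) (rule order_trans[OF add_mono[OF d d]], simp_all)
    qed
    have "\<bar>polar_ex N r p t - polar_ex k c q t\<bar> \<le> (\<Sum>i<N. \<Sum>j<N. r i * r j * (4 * pi / real k))"
    proof -
      have abs: "\<bar>\<Sum>i<N. \<Sum>j<N. d i j\<bar> \<le> (\<Sum>i<N. \<Sum>j<N. e i j)"
        if "\<And>i j. \<bar>d i j\<bar> \<le> e i j" for d e :: "nat \<Rightarrow> nat \<Rightarrow> real"
        by (intro order_trans[OF sum_abs] sum_mono that)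
      show ?thesis
        unfolding pq unfolding polar_ex_def sum_subtractf[symmetric] right_diff_distrib[symmetric]
        using mult_left_mono[OF lip mult_nonneg_nonneg[OF r r]] r
        by (intro abs) (simp only: abs_mult abs_of_nonneg)
    qed
    also have "\<dots> = (\<Sum>i<N. \<Sum>j<N. r i * r j) * (4 * pi / real k)"
      by (simp only: sum_distrib_right)
    also have "\<dots> = 4 * pi / real k * (\<Sum>i<N. r i)\<^sup>2"
      unfolding power2_eq_square sum_product by (rule mult.commute)
    finally show "\<bar>polar_ex N r p t - polar_ex k c q t\<bar> \<le> 4 * pi / real k * (\<Sum>i<N. r i)\<^sup>2" .
  qed
qed

section \<open>Continuity of excluded area functions\<close>

lemma continuous_excluded_area_zonotope: "continuous_on UNIV (\<lambda>t. excluded_area t (zonotope V))"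
proof -
  obtain N r p where "\<forall>t. excluded_area t (zonotope V) = polar_ex N r p t"
    using excluded_area_zonotope_polar[of V] by blast
  then show ?thesis by (simp add: continuous_polar_ex)
qed

text \<open>A uniform limit of continuous functions is continuous; this opens the lemmas on
  \<open>l2_inner\<close> to \<open>f\<close>.\<close>

lemma continuous_excluded_area_zonoid:
  assumes "zonoid K"
  shows "continuous_on UNIV (\<lambda>t. excluded_area t K)"
proof -
  have "\<exists>V. \<forall>t. \<bar>excluded_area t (zonotope V) - excluded_area t K\<bar> \<le> inverse (real (Suc n))" for n
    using excluded_area_zonoid_approx[OF assms, of "inverse (real (Suc n))"] by (metis inverse_positive_iff_positive of_nat_0_less_iff zero_less_Suc)
  then obtain V where V: "\<And>n t. \<bar>excluded_area t (zonotope (V n)) - excluded_area t K\<bar> \<le> inverse (real (Suc n))"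
    by metis
  show ?thesis
  proof (rule uniform_limit_theorem)
    show "uniform_limit UNIV (\<lambda>n t. excluded_area t (zonotope (V n))) (\<lambda>t. excluded_area t K) sequentially"
    proof (rule uniform_limitI)
      fix e :: real assume "e > 0"
      then have "\<forall>\<^sub>F n in sequentially. inverse (real (Suc n)) < e"
        using LIMSEQ_inverse_real_of_nat by (rule order_tendstoD(2)[rotated])
      then show "\<forall>\<^sub>F n in sequentially. \<forall>t\<in>UNIV. dist (excluded_area t (zonotope (V n))) (excluded_area t K) < e"
        by eventually_elim (use V in \<open>auto simp: dist_real_def intro: le_less_trans\<close>)
    qed
  qed (simp_all add: continuous_excluded_area_zonotope)
qed


section \<open>The estimate for minimisers\<close>

theorem theorem3p3:
  fixes K :: "(real^2) set" and f :: "real \<Rightarrow> real"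
  assumes "zonoid K"
    and "f = (\<lambda>\<theta>. excluded_area \<theta> K)"
  shows "\<exists>C1>0. \<exists>C2>0. \<forall>M\<ge>1. \<forall>k\<ge>1. \<forall>V.
      is_arg_min (\<lambda>W. (l2_norm (modes_proj M (\<lambda>\<theta>. excluded_area \<theta> (zonotope W) - f \<theta>)))\<^sup>2)
        (\<lambda>W. length W = k) V \<longrightarrow>
      (l2_norm (\<lambda>\<theta>. excluded_area \<theta> (zonotope V) - f \<theta>))\<^sup>2
        \<le> C1 / (real k)\<^sup>2 + C2 / (real M) ^ 3
          + 2 * (\<Sum>\<^sub>\<infinity>n\<in>{n::int. \<bar>n\<bar> \<ge> int M}. \<bar>cosine_mode f n\<bar>\<^sup>2)"
proof -
  let ?E = "\<lambda>V t. excluded_area t (zonotope V)" and ?I = "integral {0..2*pi} :: (real \<Rightarrow> real) \<Rightarrow> real"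
  have cf: "continuous_on UNIV f" unfolding assms(2) by (rule continuous_excluded_area_zonoid[OF assms(1)])
  have cE: "continuous_on UNIV (?E V)" for V by (rule continuous_excluded_area_zonotope)
  have cg: "continuous_on UNIV (\<lambda>t. ?E V t - f t)" for V by (intro continuous_on_diff cE cf)
  \<comment> \<open>\<open>L\<close> bounds the squared total length of a zonotope whose excluded
    area stays within 1 of \<open>f\<close>; \<open>A / k\<close> is the uniform error of the
    rounded competitor; \<open>B\<close> bounds the squared total length of the minimiser. In
    \<open>C2\<close> the 3 comes from splitting the residual into three parts.\<close>
  define L where "L = (?I f + 2 * pi) / 4"
  define A where "A = 4 * pi * L + 1"
  define B where "B = (?I f + 2 * pi * A) / 4"
  define C1 where "C1 = 2 * pi * A\<^sup>2"
  define C2 where "C2 = 3 * (B\<^sup>2 + L\<^sup>2 + 2 * pi)"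
  have If: "?I f \<ge> 0" by (intro integral_nonneg integrable_on_cont cf) (simp add: assms(2) excluded_area_def)
  have L: "L > 0" using If pi_gt_zero by (simp add: L_def add_nonneg_pos)
  have A: "A > 0" using L pi_gt_zero by (simp add: A_def add_pos_pos)
  have C: "C1 > 0" "C2 > 0" using A pi_gt_zero by (auto simp: C1_def C2_def intro!: add_nonneg_pos)
  have approx: "\<exists>N r p. (\<forall>i. r i \<ge> 0) \<and> (\<forall>t. \<bar>polar_ex N r p t - f t\<bar> \<le> e) \<and> (\<Sum>i<N. r i)\<^sup>2 \<le> L"
    if e: "0 < e" "e \<le> 1" for e
  proof -
    obtain V where V: "\<And>t. \<bar>?E V t - f t\<bar> \<le> e"
      using excluded_area_zonoid_approx[OF assms(1) e(1)] unfolding assms(2) by blast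
    obtain N r p where r: "\<forall>i. r i \<ge> 0" and eq: "\<forall>t. ?E V t = polar_ex N r p t"
      using excluded_area_zonotope_polar[of V] by blast
    note r = r[rule_format] and eq = eq[rule_format]
    have "polar_ex N r p t \<le> f t + 1" for t
      using V[of t] e(2) by (simp add: eq abs_le_iff)
    then have "?I (polar_ex N r p) \<le> ?I (\<lambda>t. f t + 1)"
      by (intro integral_le integrable_on_cont continuous_polar_ex continuous_on_add cf) auto
    also have "\<dots> = ?I f + 2 * pi"
      by (simp add: integral_add integrable_on_cont cf)
    finally have "(\<Sum>i<N. r i)\<^sup>2 \<le> L"
      using integral_polar_ex_ge[of r N p] r by (simp add: L_def)
    then show ?thesis using r V unfolding eq by blast
  qed
  have main: "(l2_norm (\<lambda>t. ?E V t - f t))\<^sup>2 \<le> C1 / (real k)\<^sup>2 + C2 / (real M) ^ 3"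
    if M: "M \<ge> 1" and k: "k \<ge> 1"
      and V: "is_arg_min (\<lambda>W. (l2_norm (modes_proj M (\<lambda>t. ?E W t - f t)))\<^sup>2) (\<lambda>W. length W = k) V"
    for M k :: nat and V
  proof -
    \<comment> \<open>Small enough for both error terms: e at most 1 / k keeps the competitor at
      order 1 / k, and e at most 1 / M^2 makes e^2 at most 1 / M^3.\<close>
    define e where "e = 1 / (real k * (real M)\<^sup>2)"
    have kM: "real k \<ge> 1" "(real M)\<^sup>2 \<ge> 1" using k M by auto
    have e: "0 < e" "e \<le> 1 / real k" "e \<le> 1 / (real M)\<^sup>2" "e \<le> 1"
      using kM mult_mono[OF kM] by (auto simp: e_def divide_simps)
    obtain N r p where r: "\<forall>i. r i \<ge> 0" and close: "\<forall>t. \<bar>polar_ex N r p t - f t\<bar> \<le> e"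
      and rL: "(\<Sum>i<N. r i)\<^sup>2 \<le> L" using approx[OF e(1,4)] by blast
    note r = r[rule_format] and close = close[rule_format]
    obtain c q where c: "\<forall>a. c a \<ge> 0"
      and cq: "\<forall>t. \<bar>polar_ex N r p t - polar_ex k c q t\<bar> \<le> 4 * pi / real k * (\<Sum>i<N. r i)\<^sup>2"
      using polar_ex_discretise[of r k N p, OF r k] by blast
    note c = c[rule_format] and cq = cq[rule_format]
    \<comment> \<open>An admissible competitor: the list has exactly \<open>k\<close> entries, and
      entries of length zero are allowed.\<close>
    define W where "W = polar_list k c q"
    have W: "\<bar>?E W t - f t\<bar> \<le> A / real k" for t
    proof -
      have "4 * pi / real k * (\<Sum>i<N. r i)\<^sup>2 \<le> 4 * pi / real k * L"
        using rL by (intro mult_left_mono) auto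
      then have "\<bar>?E W t - f t\<bar> \<le> 4 * pi / real k * L + 1 / real k"
        using cq[of t] close[of t] e(2) unfolding W_def excluded_area_polar_list[of c, OF c] by linarith
      also have "\<dots> = A / real k" by (simp add: A_def add_divide_distrib)
      finally show ?thesis .
    qed
    let ?g = "\<lambda>t. ?E V t - f t"
    have "(l2_norm (modes_proj M ?g))\<^sup>2 \<le> (l2_norm (modes_proj M (\<lambda>t. ?E W t - f t)))\<^sup>2"
      using V unfolding is_arg_min_def W_def by (metis length_polar_list not_le)
    also have "\<dots> \<le> l2_inner (\<lambda>t. ?E W t - f t) (\<lambda>t. ?E W t - f t)" by (rule modes_proj_norm_le[OF cg])
    also have "\<dots> \<le> 2 * pi * (A / real k)\<^sup>2" by (rule l2_inner_self_le_bound[OF cg W])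
    finally have proj: "(l2_norm (modes_proj M ?g))\<^sup>2 \<le> C1 / (real k)\<^sup>2"
      by (simp add: C1_def power_divide)
    obtain N' r' p' where r': "\<forall>i. r' i \<ge> 0" and EV: "\<forall>t. ?E V t = polar_ex N' r' p' t"
      using excluded_area_zonotope_polar[of V] by blast
    note r' = r'[rule_format] and EV = EV[rule_format]
    \<comment> \<open>Minimality reaches the mean through the projection: the integral of Ex(V) - f
      is at most 2 * pi * A, a bound free of \<open>M\<close> and \<open>k\<close>.\<close>
    have r'B: "(\<Sum>i<N'. r' i)\<^sup>2 \<le> B"
    proof -
      have "C1 / (real k)\<^sup>2 \<le> C1" using kM C(1) by (simp add: field_simps)
      then have "(?I ?g)\<^sup>2 \<le> 2 * pi * C1"
        using integral_le_modes_proj_norm[OF cg, of V M] proj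
        by (meson mult_left_mono order_trans pi_ge_zero mult_nonneg_nonneg zero_le_numeral)
      then have "(?I ?g)\<^sup>2 \<le> (2 * pi * A)\<^sup>2" by (simp add: C1_def power2_eq_square algebra_simps)
      then have "?I ?g \<le> 2 * pi * A" by (rule power2_le_imp_le) (use A in simp)
      then have "?I (?E V) \<le> ?I f + 2 * pi * A"
        by (simp add: integral_diff integrable_on_cont cE cf)
      then show ?thesis
        using integral_polar_ex_ge[of r' N' p'] r' unfolding EV B_def by simp
    qed
    let ?F = "polar_ex N r p" and ?G = "polar_ex N' r' p'"
    obtain h1 where h1: "h1 \<in> even_modes M"
      "l2_inner (\<lambda>t. ?G t - h1 t) (\<lambda>t. ?G t - h1 t) \<le> (\<Sum>i<N'. r' i) ^ 4 / real M ^ 3"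
      by (rule polar_ex_even_modes_approx[of r' M N' p', OF r' M])
    obtain h2 where h2: "h2 \<in> even_modes M"
      "l2_inner (\<lambda>t. ?F t - h2 t) (\<lambda>t. ?F t - h2 t) \<le> (\<Sum>i<N. r i) ^ 4 / real M ^ 3"
      by (rule polar_ex_even_modes_approx[of r M N p, OF r M])
    have sq4: "x ^ 4 / real M ^ 3 \<le> D\<^sup>2 / real M ^ 3" if "x\<^sup>2 \<le> D" for x D :: real
      using power_mono[OF that, of 2] M by (intro divide_right_mono) auto
    have p1: "l2_inner (\<lambda>t. ?G t - h1 t) (\<lambda>t. ?G t - h1 t) \<le> B\<^sup>2 / real M ^ 3"
      using h1(2) sq4[OF r'B] by linarith
    have "l2_inner (\<lambda>t. h2 t - ?F t) (\<lambda>t. h2 t - ?F t) = l2_inner (\<lambda>t. ?F t - h2 t) (\<lambda>t. ?F t - h2 t)"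
      unfolding l2_inner_def by (simp add: algebra_simps)
    then have p2: "l2_inner (\<lambda>t. h2 t - ?F t) (\<lambda>t. h2 t - ?F t) \<le> L\<^sup>2 / real M ^ 3"
      using h2(2) sq4[OF rL] by linarith
    have "l2_inner (\<lambda>t. ?F t - f t) (\<lambda>t. ?F t - f t) \<le> 2 * pi * e\<^sup>2"
      by (intro l2_inner_self_le_bound continuous_on_diff continuous_polar_ex cf close)
    also have "e\<^sup>2 \<le> 1 / real M ^ 3"
    proof -
      have "e\<^sup>2 \<le> (1 / (real M)\<^sup>2)\<^sup>2" using e by (intro power_mono) auto
      also have "\<dots> = 1 / real M ^ 4" by (simp add: power_divide)
      also have "\<dots> \<le> 1 / real M ^ 3" using M by (intro divide_left_mono power_increasing) auto
      finally show ?thesis .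
    qed
    finally have p3: "l2_inner (\<lambda>t. ?F t - f t) (\<lambda>t. ?F t - f t) \<le> 2 * pi / real M ^ 3" by simp
    \<comment> \<open>The residual is compared with \<open>h1 - h2\<close>. Inserting
      \<open>?F\<close>, whose total length is controlled, splits it into two truncation errors and
      the distance from \<open>?F\<close> to \<open>f\<close>.\<close>
    have "l2_inner (\<lambda>t. ?g t - modes_proj M ?g t) (\<lambda>t. ?g t - modes_proj M ?g t)
        \<le> l2_inner (\<lambda>t. ?g t - (h1 t - h2 t)) (\<lambda>t. ?g t - (h1 t - h2 t))"
      by (rule modes_proj_best[OF cg even_modes_diff[OF h1(1) h2(1)]])
    also have "(\<lambda>t. ?g t - (h1 t - h2 t)) = (\<lambda>t. (?G t - h1 t) + (h2 t - ?F t) + (?F t - f t))"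
      by (simp add: EV fun_eq_iff)
    also have "l2_inner \<dots> \<dots> \<le> 3 * (l2_inner (\<lambda>t. ?G t - h1 t) (\<lambda>t. ?G t - h1 t)
        + l2_inner (\<lambda>t. h2 t - ?F t) (\<lambda>t. h2 t - ?F t) + l2_inner (\<lambda>t. ?F t - f t) (\<lambda>t. ?F t - f t))"
      using h1(1) h2(1)
      by (intro l2_inner_self_add3 continuous_on_diff continuous_polar_ex cf) (auto intro: continuous_even_modes)
    also have "\<dots> \<le> 3 * (B\<^sup>2 / real M ^ 3 + L\<^sup>2 / real M ^ 3 + 2 * pi / real M ^ 3)"
      using p1 p2 p3 by (intro mult_left_mono add_mono) auto
    also have "\<dots> = C2 / real M ^ 3" by (simp add: C2_def add_divide_distrib)
    finally have "l2_inner ?g ?g \<le> C2 / real M ^ 3 + C1 / (real k)\<^sup>2"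
      unfolding modes_proj_norm[OF cg, of V M] using proj by linarith
    then show ?thesis by (simp add: l2_norm_sq cg)
  qed
  \<comment> \<open>\<open>infsum\<close> of nonnegative terms is nonnegative, also where its
    default value 0 applies, so it may be added to the right-hand side.\<close>
  have nonneg: "0 \<le> 2 * (\<Sum>\<^sub>\<infinity>n\<in>{n::int. \<bar>n\<bar> \<ge> int M}. \<bar>cosine_mode f n\<bar>\<^sup>2)" for M
    by (simp add: infsum_nonneg)
  show ?thesis
    using C main nonneg by (intro exI[of _ C1] exI[of _ C2] conjI allI impI) (auto intro: add_increasing2)
qed

end
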